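(* For every $\epsilon>0$ there exists an integer $g_\epsilon<\infty$ such that $4\leq \chi^*_o(\mathcal{P}_{g_\epsilon})\leq 4+\epsilon$.
   Context: An oriented graph is a finite directed graph with no directed cycle of length 1 or 2; its girth is the length of a shortest cycle of its underlying graph. $\mathcal{P}_g$ denotes the family of oriented planar graphs of girth at least $g$. For a set $S$ of $k$ colors, a $b$-fold oriented $k$-coloring of $G$ is a map $f$ from $V(G)$ to the $b$-element subsets of $S$ such that (i) $f(x)\cap f(y)=\emptyset$ for every arc $xy$, and (ii) for all arcs $xy, zw$, $f(x)\cap f(w)\neq\emptyset$ implies $f(y)\cap f(z)=\emptyset$. $\chi^b_o(G)$ is the minimum such $k$, $\chi^*_o(G)=\lim_{b\to\infty}\chi^b_o(G)/b=\inf_{b\ge1}\chi^b_o(G)/b$, and for a family $\mathcal{F}$, $\chi^*_o(\mathcal{F})$ is the maximum (supremum) of $\chi^*_o(G)$ over $G\in\mathcal{F}$. *)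

theory Defs
  imports "HOL-Analysis.Analysis" "HOL-Library.Extended_Real"
begin

text \<open>A finite directed graph is given by a vertex set V and an arc set A (pairs (x,y)
  meaning an arc from x to y). Vertices are natural numbers (every finite graph is
  isomorphic to one on nat).\<close>

definition oriented_graph :: "nat set \<Rightarrow> (nat \<times> nat) set \<Rightarrow> bool" where
  "oriented_graph V A \<longleftrightarrow> finite V \<and> A \<subseteq> V \<times> V \<and>
     (\<forall>x y. (x, y) \<in> A \<longrightarrow> x \<noteq> y \<and> (y, x) \<notin> A)"

definition und_adj :: "(nat \<times> nat) set \<Rightarrow> nat \<Rightarrow> nat \<Rightarrow> bool" where
  "und_adj A x y \<longleftrightarrow> (x, y) \<in> A \<or> (y, x) \<in> A"

definition und_cycle :: "nat set \<Rightarrow> (nat \<times> nat) set \<Rightarrow> nat list \<Rightarrow> bool" where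
  "und_cycle V A cs \<longleftrightarrow> length cs \<ge> 3 \<and> distinct cs \<and> set cs \<subseteq> V \<and>
     (\<forall>i < length cs. und_adj A (cs ! i) (cs ! ((i + 1) mod length cs)))"

text \<open>Girth at least g: every cycle of the underlying graph has length at least g
  (acyclic graphs have infinite girth).\<close>
definition girth_at_least :: "nat set \<Rightarrow> (nat \<times> nat) set \<Rightarrow> nat \<Rightarrow> bool" where
  "girth_at_least V A g \<longleftrightarrow> (\<forall>cs. und_cycle V A cs \<longrightarrow> length cs \<ge> g)"

definition planar :: "nat set \<Rightarrow> (nat \<times> nat) set \<Rightarrow> bool" where
  "planar V A \<longleftrightarrow> (\<exists>(p :: nat \<Rightarrow> real^2) (\<gamma> :: nat \<times> nat \<Rightarrow> real \<Rightarrow> real^2).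
     inj_on p V \<and>
     (\<forall>u v. (u, v) \<in> A \<longrightarrow> arc (\<gamma> (u, v)) \<and> pathstart (\<gamma> (u, v)) = p u \<and>
        pathfinish (\<gamma> (u, v)) = p v \<and> path_image (\<gamma> (u, v)) \<inter> p ` V = {p u, p v}) \<and>
     (\<forall>e e'. e \<in> A \<longrightarrow> e' \<in> A \<longrightarrow> e \<noteq> e' \<longrightarrow>
        path_image (\<gamma> e) \<inter> path_image (\<gamma> e') \<subseteq> p ` V))"

definition P_family :: "nat \<Rightarrow> (nat set \<times> (nat \<times> nat) set) set" where
  "P_family g = {(V, A). oriented_graph V A \<and> planar V A \<and> girth_at_least V A g}"

definition bfold_oriented_coloring ::
  "nat set \<Rightarrow> (nat \<times> nat) set \<Rightarrow> nat \<Rightarrow> nat \<Rightarrow> (nat \<Rightarrow> nat set) \<Rightarrow> bool" where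
  "bfold_oriented_coloring V A b k f \<longleftrightarrow>
     (\<forall>v \<in> V. f v \<subseteq> {..<k} \<and> card (f v) = b) \<and>
     (\<forall>x y. (x, y) \<in> A \<longrightarrow> f x \<inter> f y = {}) \<and>
     (\<forall>x y z w. (x, y) \<in> A \<longrightarrow> (z, w) \<in> A \<longrightarrow> f x \<inter> f w \<noteq> {} \<longrightarrow> f y \<inter> f z = {})"

definition chi_o_b :: "nat set \<Rightarrow> (nat \<times> nat) set \<Rightarrow> nat \<Rightarrow> nat" where
  "chi_o_b V A b = (LEAST k. \<exists>f. bfold_oriented_coloring V A b k f)"

definition chi_o_frac :: "nat set \<Rightarrow> (nat \<times> nat) set \<Rightarrow> real" where
  "chi_o_frac V A = (INF b \<in> {1..}. real (chi_o_b V A b) / real b)"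

definition chi_o_frac_family :: "(nat set \<times> (nat \<times> nat) set) set \<Rightarrow> ereal" where
  "chi_o_frac_family F = (SUP G \<in> F. ereal (chi_o_frac (fst G) (snd G)))"

end

theory Submission
  imports Defs
begin

text \<open>
  Upper bound. Put the colours on a circle of length \<open>4b + 1\<close> and give every vertex an
  interval of length \<open>b\<close>, shifting it by \<open>b\<close> or \<open>b + 1\<close> along each arc. Along a path with
  at least \<open>4b + 1\<close> edges, however oriented, the choices of shift reach every position, so the
  inner vertices of such a thread may be deleted, and restored after colouring the rest. If a planar
  graph has neither a long thread nor a vertex of degree at most one, the number of edges exceeds the
  number of vertices by a fixed proportion, which Euler's inequality forbids for large girth. Euler's
  inequality comes from the Jordan curve theorem (an edge closing a cycle splits a face) and
  Janiszewski's theorem (it borders at most two faces, and forests do not separate the plane).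

  Lower bound. Let the directed cycle of length \<open>2 ^ m\<close> have a \<open>b\<close>-fold colouring with
  sets \<open>S i\<close> and fewer than \<open>4b\<close> colours. Then no four of the sets are pairwise disjoint,
  which forces the relation \<open>S i \<inter> S (i + d) \<noteq> {}\<close> to depend on \<open>d\<close> only. The resulting
  set of differences is invariant under translation by each of its isolated points. One such point is
  \<open>2 ^ m\<close>, and a reflection argument halves it down to \<open>1\<close>, which is not a difference.
\<close>

section \<open>Adding an arc to a compact plane set\<close>

text \<open>Janiszewski's theorem, used twice: the arc meets \<open>X1\<close> in one point, and the
  arc together with \<open>X1\<close> meets \<open>X2\<close> in one point, so both intersections
  are connected. The complement of the arc alone is connected.\<close>

lemma connected_component_add_bridge:
  fixes a b :: complex
  assumes X: "compact X1" "compact X2" "X1 \<inter> X2 = {}" and \<gamma>: "arc \<gamma>"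
    and 1: "path_image \<gamma> \<inter> X1 = {pathstart \<gamma>}" and 2: "path_image \<gamma> \<inter> X2 = {pathfinish \<gamma>}"
    and ab: "connected_component (- (X1 \<union> X2)) a b" "a \<notin> path_image \<gamma>" "b \<notin> path_image \<gamma>"
  shows "connected_component (- (X1 \<union> X2 \<union> path_image \<gamma>)) a b"
proof -
  have "connected (- path_image \<gamma>)"
    by (rule connected_arc_complement[OF \<gamma>]) simp
  then have "connected_component (- path_image \<gamma>) a b"
    using ab by (auto simp: connected_iff_connected_component)
  moreover have "connected_component (- X1) a b" "connected_component (- X2) a b"
    using ab(1) by (auto intro: connected_component_of_subset)
  moreover have "compact (path_image \<gamma>)" using \<gamma> by (simp add: compact_arc_image)
  ultimately have "connected_component (- (path_image \<gamma> \<union> X1)) a b"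
    using Janiszewski[of "path_image \<gamma>" X1 a b] 1 X by (simp add: compact_imp_closed)
  moreover have "(path_image \<gamma> \<union> X1) \<inter> X2 = {pathfinish \<gamma>}" using 2 X by blast
  ultimately have "connected_component (- ((path_image \<gamma> \<union> X1) \<union> X2)) a b"
    using Janiszewski[of "path_image \<gamma> \<union> X1" X2 a b] X \<open>compact (path_image \<gamma>)\<close>
      \<open>connected_component (- X2) a b\<close>
    by (simp add: compact_Un compact_imp_closed)
  then show ?thesis by (simp add: Un_ac)
qed

text \<open>A path in \<open>X\<close> between the ends of \<open>\<gamma>\<close> contains an arc
  \<open>q\<close>, and \<open>\<gamma> +++ q\<close> is a simple closed curve. The set
  \<open>P\<close> is the image of \<open>q\<close>.\<close>

lemma closing_arc_obtain_Jordan_curve: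
  fixes \<gamma> :: "real \<Rightarrow> complex"
  assumes \<gamma>: "arc \<gamma>" and X: "path_image \<gamma> \<inter> X = {pathstart \<gamma>, pathfinish \<gamma>}"
    and pc: "path_component X (pathstart \<gamma>) (pathfinish \<gamma>)"
  obtains P inner outer where "connected P" "P \<subseteq> X" "pathstart \<gamma> \<in> P" "pathfinish \<gamma> \<in> P"
    "open inner" "connected inner" "open outer" "connected outer" "inner \<inter> outer = {}"
    "inner \<union> outer = - (P \<union> path_image \<gamma>)" "frontier inner = P \<union> path_image \<gamma>"
    "frontier outer = P \<union> path_image \<gamma>" "compact P"
proof -
  obtain h where h: "path h" "path_image h \<subseteq> X" "pathstart h = pathfinish \<gamma>" "pathfinish h = pathstart \<gamma>"
    using path_component_sym[OF pc] unfolding path_component_def by blast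
  have "pathstart \<gamma> \<noteq> pathfinish \<gamma>" using arc_distinct_ends[OF \<gamma>] by metis
  then obtain q where q: "arc q" "path_image q \<subseteq> X" "pathstart q = pathfinish \<gamma>" "pathfinish q = pathstart \<gamma>"
    using path_contains_arc[OF h(1,3,4)] h(2) by (metis order_trans)
  have sp: "simple_path (\<gamma> +++ q)"
    using simple_path_join_loop[OF \<gamma> q(1)] q X by fastforce
  have lp: "pathfinish (\<gamma> +++ q) = pathstart (\<gamma> +++ q)" using q by simp
  have im: "path_image (\<gamma> +++ q) = path_image q \<union> path_image \<gamma>"
    using q by (simp add: path_image_join Un_commute)
  obtain inner outer where "open inner" "connected inner" "open outer" "connected outer"
    "inner \<inter> outer = {}" "inner \<union> outer = - path_image (\<gamma> +++ q)"
    "frontier inner = path_image (\<gamma> +++ q)" "frontier outer = path_image (\<gamma> +++ q)"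
    using Jordan_curve[OF sp lp] by metis
  moreover have "pathstart \<gamma> \<in> path_image q" "pathfinish \<gamma> \<in> path_image q"
    using q(3,4) by (metis pathstart_in_path_image pathfinish_in_path_image)+
  moreover have "connected (path_image q)" "compact (path_image q)"
    using q(1) by (simp_all add: connected_arc_image compact_arc_image)
  ultimately show ?thesis using that[of "path_image q" inner outer] q(2) unfolding im by metis
qed

text \<open>Two of the three points lie on the same side of the Jordan curve formed by
  \<open>P\<close> and \<open>\<gamma>\<close>. This curve meets \<open>X\<close> exactly in the
  connected set \<open>P\<close>, so Janiszewski's theorem keeps these two points together.\<close>

lemma connected_component_add_cycle_arc:
  fixes a b c :: complex
  assumes X: "compact X" and \<gamma>: "arc \<gamma>" "path_image \<gamma> \<inter> X = {pathstart \<gamma>, pathfinish \<gamma>}"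
    and pc: "path_component X (pathstart \<gamma>) (pathfinish \<gamma>)"
    and ab: "connected_component (- X) a b" "connected_component (- X) a c"
    and n: "a \<notin> path_image \<gamma>" "b \<notin> path_image \<gamma>" "c \<notin> path_image \<gamma>"
  shows "connected_component (- (X \<union> path_image \<gamma>)) a b \<or> connected_component (- (X \<union> path_image \<gamma>)) a c
    \<or> connected_component (- (X \<union> path_image \<gamma>)) b c"
proof -
  obtain P inner outer where P: "connected P" "P \<subseteq> X" "pathstart \<gamma> \<in> P" "pathfinish \<gamma> \<in> P" "compact P"
    and io: "connected inner" "connected outer" "inner \<union> outer = - (P \<union> path_image \<gamma>)"
    by (rule closing_arc_obtain_Jordan_curve[OF \<gamma> pc])
  have *: "connected_component (- (X \<union> path_image \<gamma>)) x y"
    if "connected_component (- X) x y" "{x, y} \<subseteq> T" "T = inner \<or> T = outer" for x y T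
  proof -
    have "connected_component (- (P \<union> path_image \<gamma>)) x y"
      using that io unfolding connected_component_def by (intro exI[of _ T]) auto
    moreover have "X \<inter> (P \<union> path_image \<gamma>) = P"
    proof -
      have "path_image \<gamma> \<inter> X \<subseteq> P" unfolding \<gamma>(2) using P by simp
      then show ?thesis using P(2) by blast
    qed
    moreover have "compact (path_image \<gamma>)" using \<gamma> by (simp add: compact_arc_image)
    ultimately have "connected_component (- (X \<union> (P \<union> path_image \<gamma>))) x y"
      using Janiszewski[of X "P \<union> path_image \<gamma>" x y] that P X
      by (simp add: compact_imp_closed closed_Un)
    moreover have "X \<union> (P \<union> path_image \<gamma>) = X \<union> path_image \<gamma>" using P by auto
    ultimately show ?thesis by simp
  qed
  have bc: "connected_component (- X) b c" using ab by (meson connected_component_sym connected_component_trans)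
  have "{a, b, c} \<subseteq> - X" using ab connected_component_in by blast
  then have "{a, b, c} \<subseteq> inner \<union> outer" using P n io by auto
  then consider "{a, b} \<subseteq> inner \<or> {a, b} \<subseteq> outer" | "{a, c} \<subseteq> inner \<or> {a, c} \<subseteq> outer"
    | "{b, c} \<subseteq> inner \<or> {b, c} \<subseteq> outer" by fastforce
  then show ?thesis
    by cases (use *[OF ab(1)] *[OF ab(2)] *[OF bc] in metis)+
qed

text \<open>Both sides of the Jordan curve have the whole curve as frontier, so a small ball around
  a point of \<open>\<gamma>\<close> off \<open>Z\<close> contains points of each side and links
  them outside \<open>X\<close>. In the application the larger set \<open>Z\<close> carries all
  other edges, which the two points must avoid too.\<close>

lemma cycle_arc_separates:
  fixes \<gamma> :: "real \<Rightarrow> complex"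
  assumes \<gamma>: "arc \<gamma>" "path_image \<gamma> \<inter> X = {pathstart \<gamma>, pathfinish \<gamma>}"
    and pc: "path_component X (pathstart \<gamma>) (pathfinish \<gamma>)"
    and Z: "closed Z" "X \<subseteq> Z" "\<not> path_image \<gamma> \<subseteq> Z"
  obtains a b where "a \<notin> Z \<union> path_image \<gamma>" "b \<notin> Z \<union> path_image \<gamma>" "connected_component (- X) a b"
    "\<not> connected_component (- (X \<union> path_image \<gamma>)) a b"
proof -
  obtain P inner outer where P: "connected P" "P \<subseteq> X" "pathstart \<gamma> \<in> P" "pathfinish \<gamma> \<in> P" "compact P"
    and io: "open inner" "open outer" "inner \<inter> outer = {}" "inner \<union> outer = - (P \<union> path_image \<gamma>)"
       "frontier inner = P \<union> path_image \<gamma>" "frontier outer = P \<union> path_image \<gamma>"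
    by (rule closing_arc_obtain_Jordan_curve[OF \<gamma> pc])
  obtain m where m: "m \<in> path_image \<gamma>" "m \<notin> Z" using Z by auto
  then obtain r where r: "r > 0" "ball m r \<subseteq> - Z" using Z by (meson ComplI open_Compl openE)
  have "m \<in> closure inner" "m \<in> closure outer" using io(5,6) m unfolding frontier_def by blast+
  then obtain a b where ab: "a \<in> inner" "a \<in> ball m r" "b \<in> outer" "b \<in> ball m r"
    using r by (metis closure_approachable dist_commute mem_ball)
  have 1: "a \<notin> Z \<union> path_image \<gamma>" "b \<notin> Z \<union> path_image \<gamma>" using ab r io by auto
  have 2: "connected_component (- X) a b"
    unfolding connected_component_def
    by (intro exI[of _ "ball m r"]) (use r Z ab in auto)
  have 3: "\<not> connected_component (- (X \<union> path_image \<gamma>)) a b"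
  proof
    assume "connected_component (- (X \<union> path_image \<gamma>)) a b"
    then obtain T where T: "connected T" "T \<subseteq> - (X \<union> path_image \<gamma>)" "a \<in> T" "b \<in> T"
      unfolding connected_component_def by blast
    then have "T \<subseteq> inner \<union> outer" using io P by auto
    with T io ab show False using connectedD[of T inner outer] by blast
  qed
  show ?thesis using that 1 2 3 by blast
qed

section \<open>Cycles and reachability in graphs\<close>

lemma und_adj_sym: "und_adj A x y \<longleftrightarrow> und_adj A y x"
  by (auto simp: und_adj_def)

lemma und_cycleI:
  assumes "inj_on f {..n}" "2 \<le> n" "f ` {..n} \<subseteq> V"
    and "\<And>i. i < n \<Longrightarrow> und_adj A (f i) (f (Suc i))" "und_adj A (f n) (f 0)"
  shows "und_cycle V A (map f [0..<Suc n])"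
  unfolding und_cycle_def
proof (intro conjI allI impI)
  have s: "{0..<Suc n} = {..n}" by auto
  show "distinct (map f [0..<Suc n])" using assms(1) by (simp add: distinct_map s del: upt_Suc)
  show "set (map f [0..<Suc n]) \<subseteq> V" using assms(3) by (simp add: s del: upt_Suc)
  show "3 \<le> length (map f [0..<Suc n])" using assms(2) by simp
  fix i assume "i < length (map f [0..<Suc n])"
  then have "i < n \<or> i = n" by auto
  then show "und_adj A (map f [0..<Suc n] ! i)
      (map f [0..<Suc n] ! ((i + 1) mod length (map f [0..<Suc n])))"
    using assms(4,5) by (auto simp del: upt_Suc)
qed

lemma und_cycle_mono: "und_cycle V B cs \<Longrightarrow> B \<subseteq> A \<Longrightarrow> und_cycle V A cs"
  unfolding und_cycle_def und_adj_def by blast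

text \<open>Each position is sent to the arc under the step that starts there. Two positions could
  share an arc only by traversing it in opposite directions; two steps would then lead back to the
  start, impossible in length at least three.\<close>

lemma und_cycle_length_le_card:
  assumes "und_cycle V B cs" "finite B"
  shows "length cs \<le> card B"
proof -
  define l where "l = length cs"
  define nx where "nx i = Suc i mod l" for i
  have l: "l \<ge> 3" and d: "distinct cs" and adj: "\<And>i. i < l \<Longrightarrow> und_adj B (cs ! i) (cs ! nx i)"
    using assms by (auto simp: und_cycle_def l_def nx_def)
  have nx: "nx i < l" for i using l by (simp add: nx_def)
  have nx2: "nx (nx i) \<noteq> i" if "i < l" for i
    using that l by (cases "Suc i = l") (auto simp: nx_def mod_Suc)
  have eq: "cs ! i = cs ! j \<longleftrightarrow> i = j" if "i < l" "j < l" for i j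
    using that d by (simp add: nth_eq_iff_index_eq l_def)
  define h where "h i = (if (cs ! i, cs ! nx i) \<in> B then (cs ! i, cs ! nx i) else (cs ! nx i, cs ! i))" for i
  have "h ` {..<l} \<subseteq> B" using adj by (auto simp: h_def und_adj_def)
  moreover have "inj_on h {..<l}"
  proof (rule inj_onI)
    fix i j assume ij: "i \<in> {..<l}" "j \<in> {..<l}" "h i = h j"
    then have "cs ! i = cs ! j \<or> (cs ! i = cs ! nx j \<and> cs ! nx i = cs ! j)"
      by (auto simp: h_def split: if_splits)
    then have "i = j \<or> (i = nx j \<and> nx i = j)" using ij eq nx by auto
    then show "i = j" using nx2[of j] ij by auto
  qed
  ultimately have "card {..<l} \<le> card B" using assms(2) by (intro card_inj_on_le)
  then show ?thesis by (simp add: l_def)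
qed

definition reach :: "('a \<times> 'a) set \<Rightarrow> ('a \<times> 'a) set" where
  "reach B = (B \<union> B\<inverse>)\<^sup>*"

lemma reach_refl: "(x, x) \<in> reach B"
  by (simp add: reach_def)

lemma reach_trans: "(x, y) \<in> reach B \<Longrightarrow> (y, z) \<in> reach B \<Longrightarrow> (x, z) \<in> reach B"
  by (simp add: reach_def)

lemma reach_sym: "(x, y) \<in> reach B \<Longrightarrow> (y, x) \<in> reach B"
  unfolding reach_def by (metis converse_Un converse_converse rtrancl_converse converse_iff sup_commute)

lemma reach_edge: "(x, y) \<in> B \<Longrightarrow> (x, y) \<in> reach B"
  by (auto simp: reach_def)

lemma reach_mono: "B \<subseteq> C \<Longrightarrow> reach B \<subseteq> reach C"
  unfolding reach_def by (intro rtrancl_mono) auto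

lemma rtrancl_obtain_injective_walk:
  assumes "(x, y) \<in> R\<^sup>*"
  obtains f :: "nat \<Rightarrow> 'a" and n where "f 0 = x" "f n = y" "inj_on f {..n}" "\<And>i. i < n \<Longrightarrow> (f i, f (Suc i)) \<in> R"
proof -
  \<comment> \<open>A shortest walk repeats no vertex, since the part between two visits could be
    cut out.\<close>
  define n where "n = (LEAST n. (x, y) \<in> R ^^ n)"
  have n: "(x, y) \<in> R ^^ n" and least: "\<And>m. (x, y) \<in> R ^^ m \<Longrightarrow> n \<le> m"
    using assms unfolding n_def rtrancl_power by (auto intro: LeastI_ex Least_le)
  then obtain f where f: "f 0 = x" "f n = y" "\<And>i. i < n \<Longrightarrow> (f i, f (Suc i)) \<in> R"
    by (auto simp: relpow_fun_conv)
  have seg: "(f i, f (i + k)) \<in> R ^^ k" if "i + k \<le> n" for i k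
    unfolding relpow_fun_conv by (intro exI[of _ "\<lambda>t. f (i + t)"]) (use f that in auto)
  have "f i \<noteq> f j" if "i < j" "j \<le> n" for i j
  proof
    assume "f i = f j"
    then have "(x, y) \<in> R ^^ (i + (n - j))"
      unfolding relpow_add using seg[of 0 i] seg[of j "n - j"] that f(1,2) by auto
    then show False using least[of "i + (n - j)"] that by simp
  qed
  then have "inj_on f {..n}" unfolding inj_on_def by (metis atMost_iff linorder_neqE_nat)
  then show ?thesis using that f by blast
qed

lemma reach_closes_cycle:
  assumes uv: "(u, v) \<in> reach B" "u \<noteq> v" "(u, v) \<notin> B" "(v, u) \<notin> B" and BV: "B \<subseteq> V \<times> V"
  shows "\<exists>cs. und_cycle V (insert (u, v) B) cs"
proof -
  obtain f n where f: "f 0 = u" "f n = v" "inj_on f {..n}" "\<And>i. i < n \<Longrightarrow> (f i, f (Suc i)) \<in> B \<union> B\<inverse>"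
    using uv(1) rtrancl_obtain_injective_walk unfolding reach_def by metis
  have "n \<noteq> 0" using f uv(2) by (metis)
  moreover have "n \<noteq> 1" using f(1,2) f(4)[of 0] uv(3,4) by auto
  ultimately have n: "2 \<le> n" by auto
  have "f i \<in> V" if "i \<le> n" for i
  proof (cases "i = n")
    case True
    then show ?thesis using f(4)[of "n - 1"] n BV by auto
  next
    case False
    then show ?thesis using f(4)[of i] that BV by auto
  qed
  then have "und_cycle V (insert (u, v) B) (map f [0..<Suc n])"
    by (intro und_cycleI) (use f n in \<open>auto simp: und_adj_def\<close>)
  then show ?thesis by blast
qed

definition reach_classes :: "'a set \<Rightarrow> ('a \<times> 'a) set \<Rightarrow> 'a set set" where
  "reach_classes V B = (\<lambda>x. reach B `` {x}) ` V"

lemma reach_classes_mono_image: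
  assumes "B \<subseteq> C"
  shows "reach_classes V C = (\<lambda>T. reach C `` T) ` reach_classes V B"
proof -
  have "reach C `` (reach B `` {x}) = reach C `` {x}" for x
    using reach_mono[OF assms] reach_trans reach_refl by fast
  then show ?thesis by (simp add: reach_classes_def image_image)
qed

lemma card_reach_classes_mono:
  assumes "finite V" "B \<subseteq> C"
  shows "card (reach_classes V C) \<le> card (reach_classes V B)"
  unfolding reach_classes_mono_image[OF assms(2)]
  by (rule card_image_le) (simp add: reach_classes_def assms)

text \<open>Enlarging the arc set maps the old classes onto the new ones and identifies those of
  \<open>u\<close> and \<open>v\<close>, so this map is not injective.\<close>

lemma card_reach_classes_bridge:
  assumes V: "finite V" "u \<in> V" "v \<in> V" and uv: "(u, v) \<notin> reach B"
  shows "card (reach_classes V (insert (u, v) B)) < card (reach_classes V B)"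
proof -
  let ?C = "insert (u, v) B" and ?h = "\<lambda>T. reach (insert (u, v) B) `` T"
  have fin: "finite (reach_classes V B)" by (simp add: reach_classes_def V)
  have im: "reach_classes V ?C = ?h ` reach_classes V B" by (rule reach_classes_mono_image) auto
  have "(u, v) \<in> reach ?C" by (simp add: reach_edge)
  then have "reach ?C `` {u} = reach ?C `` {v}" using reach_trans reach_sym by fast
  moreover have "?h (reach B `` {x}) = reach ?C `` {x}" for x
    using reach_mono[of B ?C] reach_trans reach_refl by fast
  moreover have "reach B `` {u} \<noteq> reach B `` {v}" using uv reach_refl by fast
  ultimately have "\<not> inj_on ?h (reach_classes V B)"
    using V unfolding inj_on_def reach_classes_def by (metis imageI)
  then have "card (?h ` reach_classes V B) \<noteq> card (reach_classes V B)"
    using eq_card_imp_inj_on[OF fin] by blast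
  then show ?thesis using card_image_le[OF fin, of ?h] unfolding im by simp
qed

section \<open>Euler's inequality for plane graphs\<close>

locale plane_graph =
  fixes V :: "nat set" and A :: "(nat \<times> nat) set"
    and p :: "nat \<Rightarrow> complex" and \<gamma> :: "nat \<times> nat \<Rightarrow> real \<Rightarrow> complex"
  assumes oriented: "oriented_graph V A"
    and inj: "inj_on p V"
    and arc: "(u, v) \<in> A \<Longrightarrow> arc (\<gamma> (u, v))"
    and start: "(u, v) \<in> A \<Longrightarrow> pathstart (\<gamma> (u, v)) = p u"
    and finish: "(u, v) \<in> A \<Longrightarrow> pathfinish (\<gamma> (u, v)) = p v"
    and ends: "(u, v) \<in> A \<Longrightarrow> path_image (\<gamma> (u, v)) \<inter> p ` V = {p u, p v}"
    and cross: "e \<in> A \<Longrightarrow> e' \<in> A \<Longrightarrow> e \<noteq> e' \<Longrightarrow> path_image (\<gamma> e) \<inter> path_image (\<gamma> e') \<subseteq> p ` V"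
begin

lemma finV: "finite V" and AV: "A \<subseteq> V \<times> V"
  using oriented by (auto simp: oriented_graph_def)

lemma finA: "finite A"
  using finV AV by (meson finite_SigmaI finite_subset)

text \<open>Every vertex is drawn, whatever \<open>B\<close> is, so a further edge of
  \<open>A\<close> meets the drawing in exactly its two ends.\<close>

definition drawing :: "(nat \<times> nat) set \<Rightarrow> complex set" where
  "drawing B = p ` V \<union> (\<Union>e\<in>B. path_image (\<gamma> e))"

abbreviation same_face :: "(nat \<times> nat) set \<Rightarrow> complex \<Rightarrow> complex \<Rightarrow> bool" where
  "same_face B \<equiv> connected_component (- drawing B)"

lemma drawing_mono: "B \<subseteq> C \<Longrightarrow> drawing B \<subseteq> drawing C"
  by (auto simp: drawing_def)

lemma drawing_insert: "drawing (insert e B) = drawing B \<union> path_image (\<gamma> e)"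
  by (auto simp: drawing_def)

lemma same_face_mono: "same_face C a b \<Longrightarrow> B \<subseteq> C \<Longrightarrow> same_face B a b"
  using drawing_mono by (meson Compl_subset_Compl_iff connected_component_of_subset)

lemma compact_drawing:
  assumes "B \<subseteq> A"
  shows "compact (drawing B)"
  unfolding drawing_def
proof (intro compact_Un compact_UN)
  show "compact (p ` V)" by (simp add: finV finite_imp_compact)
  show "finite B" using assms finA finite_subset by blast
  show "compact (path_image (\<gamma> e))" if "e \<in> B" for e
    using that assms arc by (cases e) (auto intro: compact_arc_image)
qed

lemma edge_Int_drawing:
  assumes "(u, v) \<in> A" "B \<subseteq> A" "(u, v) \<notin> B"
  shows "path_image (\<gamma> (u, v)) \<inter> drawing B = {p u, p v}"
proof -
  have "path_image (\<gamma> (u, v)) \<inter> path_image (\<gamma> e) \<subseteq> p ` V" if "e \<in> B" for e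
    using that assms by (intro cross) auto
  then have "path_image (\<gamma> (u, v)) \<inter> drawing B = path_image (\<gamma> (u, v)) \<inter> p ` V"
    unfolding drawing_def by blast
  then show ?thesis using ends[OF assms(1)] by simp
qed

lemma edge_path_component:
  assumes "B \<subseteq> A" "(x, y) \<in> B"
  shows "path_component (drawing B) (p x) (p y)"
proof -
  have a: "(x, y) \<in> A" using assms by auto
  show ?thesis
    unfolding path_component_def
    by (intro exI[of _ "\<gamma> (x, y)"])
       (use assms start[OF a] finish[OF a] arc_imp_path[OF arc[OF a]] in \<open>auto simp: drawing_def\<close>)
qed

lemma reach_path_component:
  assumes "(x, y) \<in> reach B" "x \<in> V" "B \<subseteq> A"
  shows "path_component (drawing B) (p x) (p y)"
  using assms(1) unfolding reach_def
proof (induction rule: rtrancl_induct)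
  case base
  then show ?case using assms(2) by (simp add: path_component_refl drawing_def)
next
  case (step y z)
  then have "path_component (drawing B) (p y) (p z)"
    using edge_path_component[OF assms(3)] path_component_sym by blast
  then show ?case using step path_component_trans by blast
qed

text \<open>The drawing splits into two disjoint compact pieces, the component of \<open>u\<close>
  and the rest. The new edge touches each of them in one end, as
  \<open>connected_component_add_bridge\<close> requires.\<close>

lemma same_face_add_bridge:
  assumes B: "B \<subseteq> A" and uv: "(u, v) \<in> A" "(u, v) \<notin> reach B"
    and ab: "same_face B a b" "a \<notin> path_image (\<gamma> (u, v))" "b \<notin> path_image (\<gamma> (u, v))"
  shows "same_face (insert (u, v) B) a b"
proof -
  define U where "U = {x \<in> V. (u, x) \<in> reach B}"
  \<comment> \<open>Edges are sorted by their tails alone; \<open>closed_class\<close> shows that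
    the heads fall on the same side.\<close>
  define X where "X T = p ` T \<union> (\<Union>e\<in>{e \<in> B. fst e \<in> T}. path_image (\<gamma> e))" for T
  have uvV: "u \<in> V" "v \<in> V" using uv AV by auto
  have closed_class: "x \<in> U \<longleftrightarrow> y \<in> U" if "(x, y) \<in> B" for x y
  proof -
    have r: "(x, y) \<in> reach B" and xy: "x \<in> V" "y \<in> V" using that B AV reach_edge by auto
    show ?thesis
      using reach_trans[OF _ r] reach_trans[OF _ reach_sym[OF r]] xy by (auto simp: U_def)
  qed
  have vert: "z \<in> p ` T" if T: "T = U \<or> T = V - U" and z: "z \<in> X T" "z \<in> p ` V" for T z
  proof (cases "z \<in> p ` T")
    case False
    then obtain x y where e: "(x, y) \<in> B" "x \<in> T" "z \<in> path_image (\<gamma> (x, y))" using z by (auto simp: X_def)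
    then have "z \<in> {p x, p y}" using ends[of x y] B z(2) by blast
    moreover have "y \<in> T" using T e closed_class B AV by auto
    ultimately show ?thesis using e by auto
  qed
  have dj: "X U \<inter> X (V - U) = {}"
  proof (rule ccontr)
    assume "X U \<inter> X (V - U) \<noteq> {}"
    then obtain z where z: "z \<in> X U" "z \<in> X (V - U)" by blast
    have "z \<in> p ` V"
    proof (rule ccontr)
      assume n: "z \<notin> p ` V"
      then obtain e e' where "e \<in> B" "e' \<in> B" "fst e \<in> U" "fst e' \<in> V - U"
        "z \<in> path_image (\<gamma> e)" "z \<in> path_image (\<gamma> e')"
        using z unfolding X_def U_def by auto
      then have "z \<in> p ` V" using cross[of e e'] B by (metis DiffD2 IntI subsetD)
      then show False using n by simp
    qed
    then have "z \<in> p ` U" "z \<in> p ` (V - U)" using vert z by auto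
    then show False using inj unfolding U_def inj_on_def by blast
  qed
  have un: "X U \<union> X (V - U) = drawing B"
  proof -
    have "p ` U \<union> p ` (V - U) = p ` V" by (auto simp: U_def)
    moreover have "{e \<in> B. fst e \<in> U} \<union> {e \<in> B. fst e \<in> V - U} = B" using B AV by auto
    moreover have "X U \<union> X (V - U) = (p ` U \<union> p ` (V - U)) \<union>
        (\<Union>e\<in>{e \<in> B. fst e \<in> U} \<union> {e \<in> B. fst e \<in> V - U}. path_image (\<gamma> e))"
      unfolding X_def UN_Un by (simp only: Un_ac)
    ultimately show ?thesis unfolding drawing_def by simp
  qed
  have comp: "compact (X T)" if "T \<subseteq> V" for T
    unfolding X_def
  proof (intro compact_Un compact_UN)
    have "finite T" using that finV finite_subset by blast
    then show "compact (p ` T)" by (simp add: finite_imp_compact)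
    show "finite {e \<in> B. fst e \<in> T}" using B finA finite_subset by fastforce
    show "compact (path_image (\<gamma> e))" if "e \<in> {e \<in> B. fst e \<in> T}" for e
      using that B arc by (cases e) (auto intro: compact_arc_image)
  qed
  have "(u, v) \<notin> B" using uv(2) reach_edge[of u v B] by auto
  then have int: "path_image (\<gamma> (u, v)) \<inter> drawing B = {p u, p v}"
    using edge_Int_drawing uv B by blast
  have "p u \<in> X U" "p v \<in> X (V - U)"
    using uvV uv reach_refl[of u B] by (auto simp: X_def U_def)
  moreover from this have "p v \<notin> X U" "p u \<notin> X (V - U)" using dj unfolding disjoint_iff by blast+
  moreover have "path_image (\<gamma> (u, v)) \<inter> X T = {p u, p v} \<inter> X T" if "T = U \<or> T = V - U" for T
    using that un unfolding int[symmetric] by auto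
  ultimately have "path_image (\<gamma> (u, v)) \<inter> X U = {p u}" "path_image (\<gamma> (u, v)) \<inter> X (V - U) = {p v}"
    by auto
  moreover have "U \<subseteq> V" by (auto simp: U_def)
  ultimately have "connected_component (- (X U \<union> X (V - U) \<union> path_image (\<gamma> (u, v)))) a b"
    using ab by (intro connected_component_add_bridge comp dj arc[OF uv(1)])
      (simp_all add: start[OF uv(1)] finish[OF uv(1)] un)
  then show ?thesis by (simp add: un drawing_insert)
qed

text \<open>The new edge either closes a cycle, where the Jordan curve argument applies, or is a
  bridge and separates nothing. Hence an edge cuts a face into at most two.\<close>

lemma same_face_two_of_three:
  assumes B: "B \<subseteq> A" and e: "e \<in> A" "e \<notin> B"
    and ab: "same_face B a b" "same_face B a c"
    and n: "a \<notin> path_image (\<gamma> e)" "b \<notin> path_image (\<gamma> e)" "c \<notin> path_image (\<gamma> e)"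
  shows "same_face (insert e B) a b \<or> same_face (insert e B) a c \<or> same_face (insert e B) b c"
proof -
  obtain u v where uv: "e = (u, v)" by force
  show ?thesis
  proof (cases "(u, v) \<in> reach B")
    case True
    have pc: "path_component (drawing B) (pathstart (\<gamma> (u, v))) (pathfinish (\<gamma> (u, v)))"
      using reach_path_component[OF True _ B] e AV start[of u v] finish[of u v] uv by auto
    have "path_image (\<gamma> (u, v)) \<inter> drawing B = {pathstart (\<gamma> (u, v)), pathfinish (\<gamma> (u, v))}"
      using edge_Int_drawing[of u v B] start[of u v] finish[of u v] e B uv by simp
    then show ?thesis
      using connected_component_add_cycle_arc[OF compact_drawing[OF B] arc _ pc ab] n e uv
      by (simp add: drawing_insert)
  next
    case False
    then show ?thesis using same_face_add_bridge[OF B _ False ab(1)] n e uv by simp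
  qed
qed

lemma cycle_edge_separates:
  assumes B: "B \<subseteq> A" and uv: "(u, v) \<in> A" "(u, v) \<notin> B" "(u, v) \<in> reach B"
  obtains a b where "a \<notin> drawing A" "b \<notin> drawing A" "same_face B a b" "\<not> same_face (insert (u, v) B) a b"
proof -
  \<comment> \<open>\<open>?Z\<close> is the drawing of all other edges. The interior of the edge is
    nonempty and avoids it, so the separated points can be chosen off the whole drawing.\<close>
  let ?e = "(u, v)" and ?Z = "drawing (A - {(u, v)})"
  have pc: "path_component (drawing B) (pathstart (\<gamma> ?e)) (pathfinish (\<gamma> ?e))"
    using reach_path_component[OF uv(3) _ B] AV start[OF uv(1)] finish[OF uv(1)] uv by auto
  have int: "path_image (\<gamma> ?e) \<inter> drawing B = {pathstart (\<gamma> ?e), pathfinish (\<gamma> ?e)}"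
    using edge_Int_drawing[OF uv(1) B uv(2)] start[OF uv(1)] finish[OF uv(1)] by simp
  have "path_image (\<gamma> ?e) \<inter> ?Z = {pathstart (\<gamma> ?e), pathfinish (\<gamma> ?e)}"
    using edge_Int_drawing[OF uv(1), of "A - {(u, v)}"] start[OF uv(1)] finish[OF uv(1)] by auto
  then have "\<not> path_image (\<gamma> ?e) \<subseteq> ?Z"
    using nonempty_simple_path_endless[OF arc_imp_simple_path[OF arc[OF uv(1)]]] by blast
  moreover have "closed ?Z" using compact_drawing[of "A - {?e}"] compact_imp_closed by auto
  moreover have "drawing B \<subseteq> ?Z" using B uv by (intro drawing_mono) auto
  moreover have "?Z \<union> path_image (\<gamma> ?e) = drawing A"
    using drawing_insert[of ?e "A - {?e}"] uv by (simp add: insert_absorb)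
  ultimately show ?thesis
    using cycle_arc_separates[OF arc[OF uv(1)] int pc, of ?Z] that by (metis drawing_insert)
qed

text \<open>The points avoid the drawing of the whole graph, so that they stay usable as edges are
  added to \<open>B\<close>.\<close>

lemma separated_points:
  assumes "B \<subseteq> A"
  shows "\<exists>R. finite R \<and> R \<inter> drawing A = {} \<and> (\<forall>a\<in>R. \<forall>b\<in>R. a \<noteq> b \<longrightarrow> \<not> same_face B a b) \<and>
    card B + card (reach_classes V B) \<le> card R + card V"
proof -
  have "finite B" using assms finA finite_subset by blast
  then show ?thesis using assms
  \<comment> \<open>The bound is Euler's inequality, with \<open>R\<close> holding points of
    distinct faces. A bridge lowers the number of components and keeps \<open>R\<close>; an edge
    closing a cycle adds a point to \<open>R\<close>.\<close>
  proof (induction B rule: finite_induct)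
    case empty
    have "card (reach_classes V {}) \<le> card V" unfolding reach_classes_def by (rule card_image_le[OF finV])
    then show ?case by (intro exI[of _ "{}"]) auto
  next
    case (insert e B)
    obtain u v where e: "e = (u, v)" by force
    let ?C = "insert e B"
    have B: "B \<subseteq> A" "(u, v) \<in> A" "(u, v) \<notin> B" using insert e by auto
    have uvV: "u \<in> V" "v \<in> V" using B AV by auto
    obtain R where R: "finite R" "R \<inter> drawing A = {}" "\<And>a b. a \<in> R \<Longrightarrow> b \<in> R \<Longrightarrow> a \<noteq> b \<Longrightarrow> \<not> same_face B a b"
      "card B + card (reach_classes V B) \<le> card R + card V"
      using insert.IH[OF B(1)] by blast
    have C: "\<not> same_face ?C a b" if "\<not> same_face B a b" for a b
      using that same_face_mono by blast
    have cardC: "card ?C = Suc (card B)" using insert by simp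
    show ?case
    proof (cases "(u, v) \<in> reach B")
      case False
      have "card ?C + card (reach_classes V ?C) \<le> card R + card V"
        using card_reach_classes_bridge[OF finV uvV False] R(4) cardC e by simp
      then show ?thesis using R(1,2) C[OF R(3)] by (intro exI[of _ R]) simp
    next
      case True
      obtain a b where ab: "a \<notin> drawing A" "b \<notin> drawing A" "same_face B a b" "\<not> same_face ?C a b"
        using cycle_edge_separates[OF B(1,2,3) True] e by metis
      \<comment> \<open>If \<open>a\<close> shares no old face with \<open>R\<close>, it can be
        added. Otherwise \<open>a\<close> and \<open>b\<close> both lie in the old face of some
        \<open>r\<close>, and the new edge separates at least one of them from
        \<open>r\<close>.\<close>
      have "\<exists>x. x \<notin> R \<and> x \<notin> drawing A \<and> (\<forall>r\<in>R. \<not> same_face ?C r x)"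
      proof (cases "\<exists>r\<in>R. same_face B r a")
        case False
        moreover have "same_face B a a"
          using ab(3) by (meson connected_component_refl connected_component_in)
        ultimately show ?thesis using ab(1) C by (intro exI[of _ a]) blast
      next
        case True
        then obtain r where r: "r \<in> R" "same_face B r a" by blast
        have "\<not> (same_face ?C r a \<and> same_face ?C r b)"
          using ab(4) connected_component_sym connected_component_trans by metis
        then obtain x where x: "x = a \<or> x = b" "\<not> same_face ?C r x" by blast
        have rx: "same_face B r x" using x r ab(3) by (meson connected_component_trans)
        have xA: "x \<notin> drawing A" using x ab by auto
        have "\<not> same_face ?C r' x" if "r' \<in> R" for r'
        proof (cases "r' = r")
          case False
          have "\<not> same_face B r' x"
            using R(3)[OF that r(1) False] rx by (meson connected_component_sym connected_component_trans)
          then show ?thesis using C by blast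
        qed (use x in simp)
        moreover have "same_face ?C x x"
          using xA drawing_mono[OF insert.prems] by (auto intro: connected_component_refl)
        ultimately show ?thesis using xA by metis
      qed
      then obtain x where x: "x \<notin> R" "x \<notin> drawing A" "\<And>r. r \<in> R \<Longrightarrow> \<not> same_face ?C r x" by blast
      have "\<forall>a\<in>insert x R. \<forall>b\<in>insert x R. a \<noteq> b \<longrightarrow> \<not> same_face ?C a b"
        using x(3) R(3) C connected_component_sym by (metis insert_iff)
      moreover have "card ?C + card (reach_classes V ?C) \<le> card (insert x R) + card V"
        using card_reach_classes_mono[OF finV subset_insertI[of B e]] R(1,4) cardC x(1) by simp
      moreover have "finite (insert x R)" "insert x R \<inter> drawing A = {}" using R x by auto
      ultimately show ?thesis by blast
    qed
  qed
qed

text \<open>Every edge of a forest joins two components, so inserting the edges one by one never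
  separates points.\<close>

lemma forest_one_face:
  assumes "B \<subseteq> A" "\<And>cs. \<not> und_cycle V B cs" "a \<notin> drawing B" "b \<notin> drawing B"
  shows "same_face B a b"
proof -
  have "finite B" using assms finA finite_subset by blast
  then show ?thesis using assms
  proof (induction B rule: finite_induct)
    case empty
    have "connected (UNIV - p ` V)"
      by (rule connected_open_delete_finite) (use finV in auto)
    then show ?case using empty
      by (auto simp: drawing_def connected_iff_connected_component Compl_eq_Diff_UNIV)
  next
    case (insert e B)
    obtain u v where e: "e = (u, v)" by force
    have B: "B \<subseteq> A" "(u, v) \<in> A" using insert e by auto
    have uv: "u \<noteq> v" "(u, v) \<notin> B" "(v, u) \<notin> B" "B \<subseteq> V \<times> V"
      using oriented B insert(2) AV e unfolding oriented_graph_def by blast+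
    have nr: "(u, v) \<notin> reach B" using reach_closes_cycle[OF _ uv] insert.prems(2) e by blast
    have "same_face B a b"
      using insert.prems insert.IH[OF B(1)] und_cycle_mono[of V B _ "insert e B"]
      by (auto simp: drawing_insert)
    then show ?case using same_face_add_bridge[OF B nr] insert.prems(3,4) e by (auto simp: drawing_insert)
  qed
qed

text \<open>The ends of an edge are left out, since a face may touch a vertex without bordering
  every edge there.\<close>

definition boundary_edges :: "complex \<Rightarrow> (nat \<times> nat) set" where
  "boundary_edges r = {e \<in> A. (path_image (\<gamma> e) - p ` V) \<inter> closure (Collect (same_face A r)) \<noteq> {}}"

text \<open>The frontier of the face of \<open>r\<close> lies in the drawing of its boundary edges.
  If these formed a forest, the complement of that drawing would be connected and contain both
  \<open>r\<close> and \<open>s\<close>, so it would meet the frontier. Hence they contain a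
  cycle.\<close>

lemma card_boundary_edges_ge:
  assumes r: "r \<notin> drawing A" "s \<notin> drawing A" "\<not> same_face A r s" and g: "girth_at_least V A g"
  shows "g \<le> card (boundary_edges r)"
proof -
  let ?B = "boundary_edges r" and ?F = "Collect (same_face A r)"
  have B: "?B \<subseteq> A" by (auto simp: boundary_edges_def)
  have cl: "closed (drawing A)" using compact_drawing compact_imp_closed by blast
  have fr: "frontier ?F \<subseteq> drawing ?B"
  proof
    fix z assume z: "z \<in> frontier ?F"
    have "z \<in> frontier (- drawing A)"
      using frontier_of_connected_component_subset[of "- drawing A" r] z by auto
    then have zA: "z \<in> drawing A" using cl frontier_subset_eq by (auto simp: frontier_complement)
    show "z \<in> drawing ?B"
    proof (cases "z \<in> p ` V")
      case False
      then obtain e where "e \<in> A" "z \<in> path_image (\<gamma> e)" using zA by (auto simp: drawing_def)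
      moreover then have "e \<in> ?B" using z False by (auto simp: boundary_edges_def frontier_def)
      ultimately show ?thesis by (auto simp: drawing_def)
    qed (simp add: drawing_def)
  qed
  have "\<exists>cs. und_cycle V ?B cs"
  proof (rule ccontr)
    assume "\<not> ?thesis"
    then have "connected (- drawing ?B)"
      unfolding connected_iff_connected_component using forest_one_face[OF B] by auto
    moreover have "r \<in> - drawing ?B \<inter> ?F" "s \<in> - drawing ?B - ?F"
      using r drawing_mono[OF B] by (auto intro: connected_component_refl)
    ultimately have "- drawing ?B \<inter> frontier ?F \<noteq> {}" by (intro connected_Int_frontier) blast+
    then show False using fr by blast
  qed
  then obtain cs where cs: "und_cycle V ?B cs" by blast
  then have "g \<le> length cs" using g und_cycle_mono[OF cs B] by (auto simp: girth_at_least_def)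
  also have "\<dots> \<le> card ?B" using und_cycle_length_le_card[OF cs] B finA finite_subset by blast
  finally show ?thesis .
qed

text \<open>Once \<open>e\<close> is deleted, its interior is a connected set off the remaining
  drawing, and both faces have limit points on it.\<close>

lemma boundary_edge_same_face:
  assumes r: "r \<notin> drawing A" "s \<notin> drawing A" and e: "e \<in> boundary_edges r" "e \<in> boundary_edges s"
  shows "same_face (A - {e}) r s"
proof -
  obtain u v where uv: "e = (u, v)" by force
  let ?D = "- drawing (A - {e})" and ?I = "path_image (\<gamma> e) - p ` V"
  have eA: "(u, v) \<in> A" using e uv by (auto simp: boundary_edges_def)
  have I: "?I = path_image (\<gamma> e) - {pathstart (\<gamma> e), pathfinish (\<gamma> e)}"
    using ends[OF eA] start[OF eA] finish[OF eA] uv by auto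
  have ID: "?I \<subseteq> ?D" using edge_Int_drawing[OF eA, of "A - {e}"] ends[OF eA] uv by auto
  have con: "connected ?I"
    unfolding I using connected_simple_path_endless arc_imp_simple_path arc[OF eA] uv by blast
  have key: "\<exists>m\<in>?I. same_face (A - {e}) x m"
    if x: "x \<notin> drawing A" and xe: "e \<in> boundary_edges x" for x
  proof -
    let ?F = "Collect (same_face A x)"
    obtain m where m: "m \<in> ?I" "m \<in> closure ?F" using xe by (auto simp: boundary_edges_def)
    have "connected (insert m ?F)"
      by (rule connected_intermediate_closure[of ?F]) (use m closure_subset[of ?F] in auto)
    moreover have "?F \<subseteq> ?D"
      using connected_component_subset[of "- drawing A" x] drawing_mono[of "A - {e}" A] by auto
    then have "insert m ?F \<subseteq> ?D" using m ID by auto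
    moreover have "x \<in> ?F" using x by (auto intro: connected_component_refl)
    ultimately have "same_face (A - {e}) x m" unfolding connected_component_def by blast
    then show ?thesis using m by blast
  qed
  obtain m m' where m: "m \<in> ?I" "same_face (A - {e}) r m" "m' \<in> ?I" "same_face (A - {e}) s m'"
    using key r e by meson
  have "same_face (A - {e}) m m'" unfolding connected_component_def using con ID m by blast
  then show ?thesis using m by (meson connected_component_sym connected_component_trans)
qed

text \<open>Three such faces would merge when \<open>e\<close> is deleted, but restoring
  \<open>e\<close> leaves two of the three points together.\<close>

lemma card_faces_at_edge_le_2:
  assumes R: "finite R" "R \<inter> drawing A = {}" "\<And>a b. a \<in> R \<Longrightarrow> b \<in> R \<Longrightarrow> a \<noteq> b \<Longrightarrow> \<not> same_face A a b"
  shows "card {r \<in> R. e \<in> boundary_edges r} \<le> 2"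
proof (rule ccontr)
  assume "\<not> ?thesis"
  then have "3 \<le> card {r \<in> R. e \<in> boundary_edges r}" by simp
  then obtain T where T: "T \<subseteq> {r \<in> R. e \<in> boundary_edges r}" "card T = 3"
    using obtain_subset_with_card_n by metis
  then obtain a b c where abc: "T = {a, b, c}" "a \<noteq> b" "a \<noteq> c" "b \<noteq> c"
    using card_3_iff by metis
  have in_R: "a \<in> R" "b \<in> R" "c \<in> R" and bd: "e \<in> boundary_edges a" "e \<in> boundary_edges b" "e \<in> boundary_edges c"
    using T abc by auto
  have nd: "a \<notin> drawing A" "b \<notin> drawing A" "c \<notin> drawing A" using R in_R by auto
  have eA: "e \<in> A" using bd by (auto simp: boundary_edges_def)
  have ins: "insert e (A - {e}) = A" using eA by auto
  have "same_face A a b \<or> same_face A a c \<or> same_face A b c"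
    using same_face_two_of_three[of "A - {e}" e a b c] eA boundary_edge_same_face nd bd
    unfolding ins by (auto simp: drawing_def)
  then show False using R(3) in_R abc by blast
qed

text \<open>Incidences of faces and boundary edges are counted twice: \<open>R\<close> represents at
  least \<open>card A - card V\<close> faces, each with at least \<open>g\<close> boundary edges,
  and each edge borders at most two of them.\<close>

theorem euler_girth_bound:
  assumes "V \<noteq> {}" and g: "girth_at_least V A g" and E: "card V < card A"
  shows "g * (card A - card V) \<le> 2 * card A"
proof -
  obtain R where R: "finite R" "R \<inter> drawing A = {}" "\<And>a b. a \<in> R \<Longrightarrow> b \<in> R \<Longrightarrow> a \<noteq> b \<Longrightarrow> \<not> same_face A a b"
    and cR: "card A + card (reach_classes V A) \<le> card R + card V"
    using separated_points[of A] by blast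
  have "card (reach_classes V A) > 0" using assms finV by (simp add: reach_classes_def card_gt_0_iff)
  \<comment> \<open>A second face is what forces the boundary of a face to contain a cycle.\<close>
  then have two: "card R \<ge> 2" using cR E by linarith
  have ge: "g \<le> card (boundary_edges r)" if r: "r \<in> R" for r
  proof -
    have "\<not> R \<subseteq> {r}" using two card_mono[of "{r}" R] by auto
    then obtain s where "s \<in> R" "s \<noteq> r" by blast
    then show ?thesis using R(2) R(3)[OF r, of s] r by (intro card_boundary_edges_ge[of r s, OF _ _ _ g]) auto
  qed
  have "g * (card A - card V) \<le> g * card R" using cR by (intro mult_left_mono) auto
  also have "\<dots> = (\<Sum>r\<in>R. g)" by simp
  also have "\<dots> \<le> (\<Sum>r\<in>R. card (boundary_edges r))" by (intro sum_mono ge)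
  also have "\<dots> = (\<Sum>r\<in>R. card {e \<in> A. e \<in> boundary_edges r})"
    by (intro sum.cong arg_cong[of _ _ card]) (auto simp: boundary_edges_def)
  also have "\<dots> = (\<Sum>e\<in>A. card {r \<in> R. e \<in> boundary_edges r})"
    by (rule sum_multicount_gen[symmetric]) (use R finA in auto)
  also have "\<dots> \<le> (\<Sum>e\<in>A. 2)" by (intro sum_mono card_faces_at_edge_le_2 R)
  finally show ?thesis by simp
qed

end

lemma planar_euler_girth_bound:
  assumes "oriented_graph V A" "planar V A" "V \<noteq> {}" "girth_at_least V A g" "card V < card A"
  shows "g * (card A - card V) \<le> 2 * card A"
proof -
  obtain p :: "nat \<Rightarrow> real^2" and \<gamma> where p: "inj_on p V"
    and "\<forall>u v. (u, v) \<in> A \<longrightarrow> arc (\<gamma> (u, v)) \<and> pathstart (\<gamma> (u, v)) = p u \<and>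
        pathfinish (\<gamma> (u, v)) = p v \<and> path_image (\<gamma> (u, v)) \<inter> p ` V = {p u, p v}"
    and "\<forall>e e'. e \<in> A \<longrightarrow> e' \<in> A \<longrightarrow> e \<noteq> e' \<longrightarrow> path_image (\<gamma> e) \<inter> path_image (\<gamma> e') \<subseteq> p ` V"
    using assms(2) unfolding planar_def by (elim exE conjE)
  note \<gamma> = this(2)[rule_format] and cr = this(3)[rule_format]
  \<comment> \<open>The plane is identified with the complex numbers, for which the Jordan curve
    theorem and Janiszewski's theorem are stated.\<close>
  define h :: "real^2 \<Rightarrow> complex" where "h z = Complex (z $ 1) (z $ 2)" for z
  have inj: "inj h" by (auto simp: inj_def h_def vec_eq_iff forall_2)
  have cont: "continuous_on S h" for S
    unfolding h_def Complex_eq by (intro continuous_intros)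
  interpret plane_graph V A "h \<circ> p" "\<lambda>e. h \<circ> \<gamma> e"
  proof
    show "inj_on (h \<circ> p) V" using p inj by (simp add: comp_inj_on inj_on_subset)
    show "path_image (h \<circ> \<gamma> e) \<inter> path_image (h \<circ> \<gamma> e') \<subseteq> (h \<circ> p) ` V" if "e \<in> A" "e' \<in> A" "e \<noteq> e'" for e e'
      using cr[OF that] inj by (auto simp: path_image_compose image_comp[symmetric] simp flip: image_Int)
    fix u v assume uv: "(u, v) \<in> A"
    show "arc (h \<circ> \<gamma> (u, v))"
      using \<gamma>[OF uv] cont inj unfolding arc_def
      by (auto intro: path_continuous_image comp_inj_on inj_on_subset)
    show "pathstart (h \<circ> \<gamma> (u, v)) = (h \<circ> p) u" "pathfinish (h \<circ> \<gamma> (u, v)) = (h \<circ> p) v"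
      using \<gamma>[OF uv] by (simp_all add: pathstart_compose pathfinish_compose)
    have "path_image (h \<circ> \<gamma> (u, v)) \<inter> (h \<circ> p) ` V = h ` (path_image (\<gamma> (u, v)) \<inter> p ` V)"
      unfolding image_Int[OF inj] by (simp add: path_image_compose image_image)
    then show "path_image (h \<circ> \<gamma> (u, v)) \<inter> (h \<circ> p) ` V = {(h \<circ> p) u, (h \<circ> p) v}"
      using \<gamma>[OF uv] by simp
  qed (rule assms)
  show ?thesis using euler_girth_bound assms by blast
qed

section \<open>Induced subgraphs\<close>

lemma planar_induced_subgraph:
  assumes "planar V A" "W \<subseteq> V"
  shows "planar W (A \<inter> W \<times> W)"
proof -
  obtain p :: "nat \<Rightarrow> real^2" and \<gamma> where p: "inj_on p V"
    and "\<forall>u v. (u, v) \<in> A \<longrightarrow> arc (\<gamma> (u, v)) \<and> pathstart (\<gamma> (u, v)) = p u \<and>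
        pathfinish (\<gamma> (u, v)) = p v \<and> path_image (\<gamma> (u, v)) \<inter> p ` V = {p u, p v}"
    and "\<forall>e e'. e \<in> A \<longrightarrow> e' \<in> A \<longrightarrow> e \<noteq> e' \<longrightarrow> path_image (\<gamma> e) \<inter> path_image (\<gamma> e') \<subseteq> p ` V"
    using assms(1) unfolding planar_def by (elim exE conjE)
  note \<gamma> = this(2)[rule_format] and cr = this(3)[rule_format]
  show ?thesis
    unfolding planar_def
  proof (intro exI conjI allI impI)
    show "inj_on p W" using p assms inj_on_subset by blast
    fix u v assume uv: "(u, v) \<in> A \<inter> W \<times> W"
    show "arc (\<gamma> (u, v))" "pathstart (\<gamma> (u, v)) = p u" "pathfinish (\<gamma> (u, v)) = p v"
      using \<gamma> uv by auto
    have "path_image (\<gamma> (u, v)) \<inter> p ` V = {p u, p v}" using \<gamma> uv by auto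
    moreover have "p ` W \<subseteq> p ` V" "{p u, p v} \<subseteq> p ` W" using assms uv by auto
    ultimately show "path_image (\<gamma> (u, v)) \<inter> p ` W = {p u, p v}" by blast
  next
    fix e e' assume e: "e \<in> A \<inter> W \<times> W" "e' \<in> A \<inter> W \<times> W" "e \<noteq> e'"
    obtain u v where uv: "e = (u, v)" by force
    \<comment> \<open>A common point is a drawn vertex on \<open>e\<close>, hence an end of
      \<open>e\<close>, and both ends belong to \<open>W\<close>.\<close>
    have "path_image (\<gamma> e) \<inter> path_image (\<gamma> e') \<subseteq> path_image (\<gamma> e) \<inter> p ` V" using cr[of e e'] e by auto
    also have "\<dots> = {p u, p v}" using \<gamma> e uv by auto
    also have "\<dots> \<subseteq> p ` W" using e uv by auto
    finally show "path_image (\<gamma> e) \<inter> path_image (\<gamma> e') \<subseteq> p ` W" .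
  qed
qed

lemma P_family_induced_subgraph:
  assumes "(V, A) \<in> P_family g" "W \<subseteq> V"
  shows "(W, A \<inter> W \<times> W) \<in> P_family g"
proof -
  have "und_cycle V A cs" if "und_cycle W (A \<inter> W \<times> W) cs" for cs
    using that assms(2) by (auto simp: und_cycle_def und_adj_def)
  moreover have "oriented_graph W (A \<inter> W \<times> W)"
    using assms finite_subset unfolding P_family_def oriented_graph_def by blast
  ultimately show ?thesis
    using assms planar_induced_subgraph unfolding P_family_def girth_at_least_def by auto
qed

section \<open>Leaves and threads in planar graphs of large girth\<close>

abbreviation nbrs :: "(nat \<times> nat) set \<Rightarrow> nat \<Rightarrow> nat set" where
  "nbrs A v \<equiv> {y. und_adj A v y}"

text \<open>Only the two ends, whose degree is unrestricted, attach to the rest of the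
  graph.\<close>

definition thread :: "(nat \<times> nat) set \<Rightarrow> nat \<Rightarrow> (nat \<Rightarrow> nat) \<Rightarrow> bool" where
  "thread A L x \<longleftrightarrow> inj_on x {..L} \<and> (\<forall>i<L. und_adj A (x i) (x (Suc i))) \<and>
     (\<forall>i. Suc i < L \<longrightarrow> nbrs A (x (Suc i)) = {x i, x (Suc (Suc i))})"

text \<open>Two visits to a vertex at minimal distance would close a cycle with at most
  \<open>n\<close> edges, fewer than \<open>g\<close>. Distances one and two are excluded by the
  absence of loops and by \<open>nb\<close>.\<close>

lemma nonbacktracking_walk_inj:
  assumes G: "oriented_graph V A" "girth_at_least V A g" and n: "n < g"
    and adj: "\<And>i. i < n \<Longrightarrow> und_adj A (x i) (x (Suc i))"
    and nb: "\<And>i. Suc (Suc i) \<le> n \<Longrightarrow> x (Suc (Suc i)) \<noteq> x i"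
  shows "inj_on x {..n}"
proof -
  have AV: "A \<subseteq> V \<times> V" and loop: "\<And>a. (a, a) \<notin> A" using G(1) by (auto simp: oriented_graph_def)
  have ne: "x i \<noteq> x (i + d)" if "d > 0" "i + d \<le> n" for d i
    using that
  proof (induction d arbitrary: i rule: less_induct)
    case (less d)
    show ?case
    proof
      assume eq: "x i = x (i + d)"
      have "d \<noteq> 1" using adj[of i] eq loop less.prems by (auto simp: und_adj_def)
      moreover have "d \<noteq> 2" using nb[of i] eq less.prems by auto
      ultimately obtain e where d: "d = Suc e" "2 \<le> e" using less.prems by (cases d) auto
      have inj: "inj_on (\<lambda>t. x (i + t)) {..e}"
      proof (rule linorder_inj_onI)
        fix s t assume "s < t" "s \<in> {..e}" "t \<in> {..e}"
        then show "x (i + s) \<noteq> x (i + t)" using less.IH[of "t - s" "i + s"] less.prems d by auto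
      qed auto
      have "und_cycle V A (map (\<lambda>t. x (i + t)) [0..<Suc e])"
      proof (rule und_cycleI[OF inj d(2)])
        show "und_adj A (x (i + t)) (x (i + Suc t))" if "t < e" for t
          using adj[of "i + t"] that less.prems d by simp
        show "und_adj A (x (i + e)) (x (i + 0))" using adj[of "i + e"] eq less.prems d by simp
        show "(\<lambda>t. x (i + t)) ` {..e} \<subseteq> V"
        proof clarify
          fix t assume "t \<le> e"
          then show "x (i + t) \<in> V"
            using adj[of "i + t"] AV less.prems d by (auto simp: und_adj_def)
        qed
      qed
      then have "g \<le> Suc e" using G(2) unfolding girth_at_least_def by fastforce
      then show False using n less.prems d by simp
    qed
  qed
  show ?thesis
  proof (rule linorder_inj_onI)
    fix s t assume "s < t" "s \<in> {..n}" "t \<in> {..n}"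
    then show "x s \<noteq> x t" using ne[of "t - s" s] by simp
  qed auto
qed

lemma sum_card_nbrs:
  assumes "oriented_graph V A"
  shows "(\<Sum>v\<in>V. card (nbrs A v)) = 2 * card A"
proof -
  have V: "finite V" and AV: "A \<subseteq> V \<times> V" and asym: "\<And>x y. (x, y) \<in> A \<Longrightarrow> (y, x) \<notin> A"
    using assms by (auto simp: oriented_graph_def)
  have finA: "finite A" using V AV by (meson finite_SigmaI finite_subset)
  have fin: "finite (nbrs A v)" for v
    by (rule finite_subset[OF _ V]) (use AV in \<open>auto simp: und_adj_def\<close>)
  have "(\<Sum>v\<in>V. card (nbrs A v)) = card (SIGMA v:V. nbrs A v)"
    using V fin by (simp add: card_SigmaI)
  also have "(SIGMA v:V. nbrs A v) = A \<union> A\<inverse>" using AV by (auto simp: und_adj_def)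
  also have "card (A \<union> A\<inverse>) = card A + card (A\<inverse>)"
    by (rule card_Un_disjoint) (use finA asym in auto)
  finally show ?thesis by (simp add: card_inverse)
qed

text \<open>Let \<open>e\<close> be the sum of all degrees minus two. At most \<open>e\<close>
  vertices have degree at least three, and their degrees sum to at most \<open>3 * e\<close>. Every
  other vertex is reached from a half-edge at one of them by fewer than \<open>L\<close> forced
  steps, as otherwise a thread would start at it; so there are at most \<open>L * (3 * e)\<close> of
  these.\<close>

lemma no_thread_card_le:
  assumes G: "oriented_graph V A" "girth_at_least V A g" and L: "L < g"
    and deg: "\<And>v. v \<in> V \<Longrightarrow> 2 \<le> card (nbrs A v)"
    and no: "\<And>x. \<not> thread A L x"
  shows "int (card V) \<le> (3 * int L + 1) * (2 * int (card A) - 2 * int (card V))"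
proof -
  have V: "finite V" and AV: "A \<subseteq> V \<times> V" using G by (auto simp: oriented_graph_def)
  have nV: "x \<in> V \<and> y \<in> V" if "und_adj A x y" for x y using that AV by (auto simp: und_adj_def)
  have fin: "finite (nbrs A v)" for v
    by (rule finite_subset[OF _ V]) (use nV in auto)
  define D where "D = {v \<in> V. 3 \<le> card (nbrs A v)}"
  define T where "T = (SIGMA d:D. nbrs A d)"
  \<comment> \<open>A pair holds the previous and the current vertex of a walk that never turns
    back. At a vertex of degree two the choice is forced.\<close>
  define nxt where "nxt = (\<lambda>(w, x). (x, SOME y. und_adj A x y \<and> y \<noteq> w))"
  have D: "finite D" "D \<subseteq> V" using V by (auto simp: D_def)
  have finT: "finite T" using D fin by (auto simp: T_def)
  have two: "nbrs A v = {a, b}" if "v \<in> V - D" "und_adj A v a" "und_adj A v b" "a \<noteq> b" for v a b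
  proof -
    have "card (nbrs A v) = 2" using that deg[of v] by (auto simp: D_def)
    then show ?thesis using that card_subset_eq[OF fin, of "{a, b}" v] by simp
  qed
  have "V - D \<subseteq> (\<Union>i<L. (\<lambda>e. snd ((nxt ^^ i) e)) ` T)"
  proof
    fix v assume v: "v \<in> V - D"
    have ex: "\<exists>y. und_adj A x y \<and> y \<noteq> w" if "x \<in> V" for x w
    proof (rule ccontr)
      assume "\<not> ?thesis"
      then have "nbrs A x \<subseteq> {w}" by auto
      then have "card (nbrs A x) \<le> card {w}" by (intro card_mono) auto
      then show False using deg[OF that] by simp
    qed
    have nxt: "und_adj A x (snd (nxt (w, x))) \<and> snd (nxt (w, x)) \<noteq> w" if "x \<in> V" for x w
      using someI_ex[OF ex[OF that, of w]] by (simp add: nxt_def)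
    obtain a where a: "und_adj A v a" using ex[of v v] v by auto
    define s where "s i = (nxt ^^ i) (v, a)" for i
    define x where "x i = fst (s i)" for i
    have sSuc: "s (Suc i) = nxt (s i)" for i by (simp add: s_def)
    have s: "s i = (x i, x (Suc i))" for i
      unfolding x_def sSuc by (cases "s i") (simp add: nxt_def)
    have nx: "snd (nxt (x i, x (Suc i))) = x (Suc (Suc i))" for i
      using sSuc[of i] s[of i] s[of "Suc i"] by (metis snd_conv)
    have x0: "x 0 = v" by (simp add: x_def s_def)
    have adj: "und_adj A (x i) (x (Suc i))" for i
    proof (induction i)
      case 0
      have "x (Suc 0) = a" by (simp add: x_def s_def nxt_def)
      then show ?case using a x0 by simp
    next
      case (Suc i)
      then show ?case using nxt[of "x (Suc i)" "x i"] nV nx[of i] by auto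
    qed
    have nb: "x (Suc (Suc i)) \<noteq> x i" for i
      using nxt[of "x (Suc i)" "x i"] nV[OF adj[of i]] nx[of i] by auto
    have xV: "x i \<in> V" for i using nV adj by blast
    have inj: "inj_on x {..L}" using nonbacktracking_walk_inj[OF G L] adj nb by blast
    have nbr: "nbrs A (x (Suc i)) = {x i, x (Suc (Suc i))}" if "x (Suc i) \<notin> D" for i
      using two[of "x (Suc i)" "x i" "x (Suc (Suc i))"] that xV adj nb[of i] und_adj_sym by auto
    \<comment> \<open>A walk whose inner vertices all avoid \<open>D\<close> would be a
      thread.\<close>
    have "\<exists>j. Suc j < L \<and> x (Suc j) \<in> D"
      using no[of x] inj adj nbr unfolding thread_def by blast
    then obtain j where j: "Suc j < L" "x (Suc j) \<in> D"
      and least: "\<And>i. i < j \<Longrightarrow> x (Suc i) \<notin> D"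
      using exists_least_iff[of "\<lambda>j. Suc j < L \<and> x (Suc j) \<in> D"] by (meson Suc_mono less_trans)
    \<comment> \<open>Strictly between \<open>v\<close> and the first later vertex in
      \<open>D\<close> all degrees are two, so \<open>nxt\<close> retraces the walk from there back
      to \<open>v\<close>.\<close>
    have rev_step: "nxt (x (Suc (Suc i)), x (Suc i)) = (x (Suc i), x i)" if "i < j" for i
    proof -
      have "und_adj A (x (Suc i)) y \<longleftrightarrow> y = x i \<or> y = x (Suc (Suc i))" for y
        using nbr[OF least[OF that]] by auto
      then have "(SOME y. und_adj A (x (Suc i)) y \<and> y \<noteq> x (Suc (Suc i))) = x i"
        using nb[of i] by (intro some_equality) auto
      then show ?thesis by (simp add: nxt_def)
    qed
    have "(nxt ^^ i) (x (Suc j), x j) = (x (Suc (j - i)), x (j - i))" if "i \<le> j" for i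
      using that
    proof (induction i)
      case (Suc i)
      then have "j - i = Suc (j - Suc i)" by auto
      then show ?case using Suc rev_step[of "j - Suc i"] by simp
    qed simp
    from this[of j] have "v = snd ((nxt ^^ j) (x (Suc j), x j))" using x0 by simp
    moreover have "(x (Suc j), x j) \<in> T" using j adj[of j] und_adj_sym by (auto simp: T_def)
    ultimately show "v \<in> (\<Union>i<L. (\<lambda>e. snd ((nxt ^^ i) e)) ` T)" using j by (intro UN_I[of j]) auto
  qed
  then have "card (V - D) \<le> card (\<Union>i<L. (\<lambda>e. snd ((nxt ^^ i) e)) ` T)"
    using finT by (intro card_mono) auto
  also have "\<dots> \<le> (\<Sum>i<L. card ((\<lambda>e. snd ((nxt ^^ i) e)) ` T))" by (rule card_UN_le) simp
  also have "\<dots> \<le> (\<Sum>i<L. card T)" by (intro sum_mono card_image_le finT)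
  finally have V2: "card (V - D) \<le> L * card T" by simp
  define e where "e = 2 * int (card A) - 2 * int (card V)"
  have "e = (\<Sum>v\<in>V. int (card (nbrs A v)) - 2)"
    using sum_card_nbrs[OF G(1)] unfolding e_def
    by (simp add: sum_subtractf flip: of_nat_sum)
  also have "\<dots> = (\<Sum>v\<in>V - D. int (card (nbrs A v)) - 2) + (\<Sum>v\<in>D. int (card (nbrs A v)) - 2)"
    by (rule sum.subset_diff) (use D V in auto)
  also have "(\<Sum>v\<in>V - D. int (card (nbrs A v)) - 2) = 0"
    by (rule sum.neutral) (use deg in \<open>force simp: D_def\<close>)
  finally have e: "e = (\<Sum>v\<in>D. int (card (nbrs A v)) - 2)" by simp
  have "int (card T) = (\<Sum>v\<in>D. int (card (nbrs A v)))"
    using D fin by (simp add: T_def card_SigmaI)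
  also have "\<dots> \<le> (\<Sum>v\<in>D. 3 * (int (card (nbrs A v)) - 2))" by (rule sum_mono) (auto simp: D_def)
  finally have T3: "int (card T) \<le> 3 * e" by (simp add: e sum_distrib_left)
  have "int (card D) = (\<Sum>v\<in>D. 1)" by simp
  also have "\<dots> \<le> e" unfolding e by (rule sum_mono) (auto simp: D_def)
  finally have De: "int (card D) \<le> e" .
  have "card V = card (V - D) + card D" using D V by (simp add: card_Diff_subset card_mono)
  then have "int (card V) \<le> int L * int (card T) + int (card D)"
    using V2 by (simp flip: of_nat_mult of_nat_add)
  also have "\<dots> \<le> int L * (3 * e) + e" using T3 De by (intro add_mono mult_left_mono) auto
  finally show ?thesis by (simp add: e_def algebra_simps)
qed

text \<open>With \<open>E\<close> more edges than vertices, the lack of threads bounds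
  \<open>card V\<close> by \<open>(6 * L + 2) * E\<close>. Euler's inequality then bounds
  \<open>g * E\<close> by \<open>2 * card V + 2 * E\<close>, thus by
  \<open>(12 * L + 6) * E\<close>, one short of the assumed girth.\<close>

lemma leaf_or_thread:
  assumes G: "(V, A) \<in> P_family g" "V \<noteq> {}" and g: "12 * L + 7 \<le> g"
  shows "(\<exists>v\<in>V. \<exists>u. nbrs A v \<subseteq> {u}) \<or> (\<exists>x. thread A L x)"
proof (rule ccontr)
  assume n: "\<not> ?thesis"
  have P: "oriented_graph V A" "planar V A" "girth_at_least V A g" using G by (auto simp: P_family_def)
  have V: "finite V" and AV: "A \<subseteq> V \<times> V" using P by (auto simp: oriented_graph_def)
  have fin: "finite (nbrs A v)" for v
    by (rule finite_subset[OF _ V]) (use AV in \<open>auto simp: und_adj_def\<close>)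
  have deg: "2 \<le> card (nbrs A v)" if "v \<in> V" for v
  proof (rule ccontr)
    assume "\<not> ?thesis"
    then have "card (nbrs A v) \<le> Suc 0" by simp
    then have "\<exists>u. nbrs A v \<subseteq> {u}" unfolding card_le_Suc0_iff_eq[OF fin] by blast
    then show False using n that by blast
  qed
  define E where "E = int (card A) - int (card V)"
  have le: "int (card V) \<le> (3 * int L + 1) * (2 * int (card A) - 2 * int (card V))"
    by (rule no_thread_card_le[OF P(1,3) _ deg]) (use g n in auto)
  then have le': "int (card V) \<le> (6 * int L + 2) * E" by (simp add: E_def algebra_simps)
  have "card V > 0" using V G by (simp add: card_gt_0_iff)
  then have "0 < (6 * int L + 2) * E" using le' by linarith
  then have E: "E > 0" by (simp add: zero_less_mult_iff)
  then have lt: "card V < card A" by (simp add: E_def)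
  have "g * (card A - card V) \<le> 2 * card A" by (rule planar_euler_girth_bound[OF P(1,2) G(2) P(3) lt])
  then have "int (g * (card A - card V)) \<le> int (2 * card A)" by (simp only: of_nat_le_iff)
  then have "int g * E \<le> 2 * int (card A)" using lt by (simp add: E_def of_nat_diff)
  also have "\<dots> = 2 * int (card V) + 2 * E" by (simp add: E_def)
  also have "\<dots> \<le> (12 * int L + 6) * E" using le' by (simp add: algebra_simps)
  finally have "int g \<le> 12 * int L + 6" using E by (simp add: mult_le_cancel_right)
  then show False using g by linarith
qed

section \<open>Directed cycles of dyadic length\<close>

text \<open>In the application \<open>P d\<close> says that \<open>S i\<close> and
  \<open>S (i + d)\<close> meet; \<open>step\<close> reflects condition (ii) on colourings, and
  \<open>no4\<close> the lack of four pairwise disjoint sets.\<close>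

lemma no_dyadic_period:
  fixes P :: "int \<Rightarrow> bool"
  assumes P0: "P 0" and sym: "\<And>d. P (- d) \<longleftrightarrow> P d" and step: "\<And>d. P d \<Longrightarrow> \<not> P (d + 2)"
    and no4: "\<And>a c e. P a \<or> P c \<or> P e \<or> P (c - a) \<or> P (e - a) \<or> P (e - c)"
    and per: "\<And>d. P (d + 2 ^ m) \<longleftrightarrow> P d"
  shows False
proof -
  have n1: "\<not> P 1" using step[of "-1"] sym[of 1] by auto
  have n2: "\<not> P 2" using step[of 0] P0 by auto
  \<comment> \<open>Apply \<open>no4\<close> to the positions 0, \<open>a\<close>,
    \<open>a + 1\<close>, \<open>a + c\<close>: every difference but \<open>a + c\<close> is
    excluded.\<close>
  have pair_sum: "P (a + c)" if "\<not> P a" "\<not> P (a + 1)" "\<not> P (c - 1)" "\<not> P c" for a c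
    using no4[of a "a + 1" "a + c"] that n1 by (auto simp: algebra_simps)
  have noAAA: "P x \<or> P (x + 1) \<or> P (x + 2)" for x
    using no4[of x "x + 1" "x + 2"] n1 n2 by (auto simp: algebra_simps)
  define single where "single s \<longleftrightarrow> P s \<and> \<not> P (s + 1) \<and> \<not> P (s - 1)" for s
  \<comment> \<open>The two gap points after \<open>l\<close>, combined with the two before
    \<open>s\<close> and the two after \<open>s\<close>, give \<open>P (l + s)\<close> and
    \<open>P (l + s + 3)\<close>; the latter excludes \<open>l + s + 1\<close>.\<close>
  have single_shift_last: "P (l + s) \<and> \<not> P (l + s + 1)" if "single s" "P l" "\<not> P (l + 1)" for s l
  proof -
    have l2: "\<not> P (l + 1 + 1)" using step[OF \<open>P l\<close>] by (simp add: algebra_simps)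
    have s1: "\<not> P (s - 1)" "\<not> P (s + 1)" "P s" using that by (auto simp: single_def)
    have s2: "\<not> P (s - 2)" using step[of "s - 2"] s1 by auto
    have s3: "\<not> P (s + 2)" using step[of s] s1 by auto
    have "P (l + 1 + (s - 1))" by (rule pair_sum) (use that l2 s1 s2 in auto)
    moreover have "P (l + 1 + (s + 2))" by (rule pair_sum) (use that l2 s1 s3 in \<open>auto simp: add.commute\<close>)
    ultimately show ?thesis using step[of "l + s + 1"] by (auto simp: algebra_simps)
  qed
  have single_shift: "P (x + s)" if "single s" "P x" for s x
  proof (cases "P (x + 1)")
    case False
    then show ?thesis using single_shift_last that by blast
  next
    case True
    \<comment> \<open>Here \<open>x\<close> starts a run of two, so \<open>- x\<close> ends one, and
      the previous case applies after reflection in 0.\<close>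
    have "\<not> P (x - 1)" using step[of "x - 1"] True by (auto simp: algebra_simps)
    then have "\<not> P (- x + 1)" using sym[of "x - 1"] by simp
    moreover have "P (- x)" using that sym by simp
    moreover have "single (- s)"
      using that(1) sym[of s] sym[of "s + 1"] sym[of "s - 1"] by (auto simp: single_def)
    ultimately have "P (- x + - s)" using single_shift_last by blast
    then show ?thesis using sym[of "x + s"] by simp
  qed
  have single_period: "P (x + s) \<longleftrightarrow> P x" if "single s" for s x
  proof -
    have "single (- s)"
      using that(1) sym[of s] sym[of "s + 1"] sym[of "s - 1"] by (auto simp: single_def)
    then show ?thesis using single_shift[OF that] single_shift[of "- s" "x + s"] by auto
  qed
  \<comment> \<open>Being a period, \<open>2 ^ m\<close> is isolated because 0 is.\<close>
  have top: "single (2 ^ m)"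
    using per[of 0] per[of 1] per[of "-1"] P0 n1 sym[of 1] by (simp add: single_def algebra_simps)
  \<comment> \<open>Modulo the period \<open>2h\<close>, the point \<open>h\<close> is fixed by negation, so the run of
    \<open>P\<close> or of \<open>\<not> P\<close> through \<open>h\<close> is symmetric about \<open>h\<close>, hence of odd length. Runs of \<open>P\<close> have length
    1 or 2, and runs of \<open>\<not> P\<close> have length 2.\<close>
  have half: "single h" if "single (h + h)" for h
  proof -
    have refl: "P (h + t) \<longleftrightarrow> P (h - t)" for t
      using single_period[OF that, of "t - h"] sym[of "t - h"] by (simp add: algebra_simps)
    have "P (h - 1) \<Longrightarrow> \<not> P (h + 1)" using step[of "h - 1"] by (simp add: add.commute)
    with refl[of 1] have both: "\<not> P (h - 1)" "\<not> P (h + 1)" by auto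
    show ?thesis
    proof (cases "P h")
      case True
      then show ?thesis using both by (simp add: single_def)
    next
      case False
      then show ?thesis using noAAA[of "h - 1"] both by (simp add: add.commute)
    qed
  qed
  have "single (2 ^ (m - j))" if "j \<le> m" for j
    using that
  proof (induction j)
    case 0 then show ?case using top by simp
  next
    case (Suc j)
    then have "(2::int) ^ (m - j) = 2 ^ (m - Suc j) + 2 ^ (m - Suc j)"
      by (simp add: Suc_diff_Suc flip: mult_2 power_Suc)
    then show ?case using Suc half by simp
  qed
  from this[of m] show False using n1 by (simp add: single_def)
qed

text \<open>\<open>S\<close> is a colouring of the cycle unrolled along the integers. Four pairwise
  disjoint sets would use \<open>4 * b\<close> colours; with fewer colours, meeting depends on the
  difference of indices only, which \<open>no_dyadic_period\<close> refutes.\<close>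

lemma dyadic_cycle_colors_ge:
  fixes S :: "int \<Rightarrow> nat set"
  assumes S: "\<And>i. S i \<subseteq> {..<k}" "\<And>i. card (S i) = b"
    and d1: "\<And>i. S i \<inter> S (i + 1) = {}"
    and d2: "\<And>i j. S i \<inter> S (j + 1) \<noteq> {} \<Longrightarrow> S (i + 1) \<inter> S j = {}"
    and per: "\<And>i. S (i + 2 ^ m) = S i"
  shows "4 * b \<le> k"
proof (rule ccontr)
  assume k: "\<not> 4 * b \<le> k"
  have fin: "finite (S i)" for i using S(1) finite_subset by blast
  define M where "M i j \<longleftrightarrow> S i \<inter> S j \<noteq> {}" for i j
  have Msym: "M i j \<longleftrightarrow> M j i" for i j by (auto simp: M_def)
  have four: "M i j \<or> M i l \<or> M i r \<or> M j l \<or> M j r \<or> M l r" for i j l r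
  proof (rule ccontr)
    assume "\<not> ?thesis"
    then have dj: "S i \<inter> S j = {}" "(S i \<union> S j) \<inter> S l = {}" "(S i \<union> S j \<union> S l) \<inter> S r = {}"
      unfolding M_def by blast+
    have "card (S i \<union> S j \<union> S l \<union> S r) = 4 * b"
      using dj by (simp add: card_Un_disjoint fin S(2))
    moreover have "card (S i \<union> S j \<union> S l \<union> S r) \<le> card {..<k}"
      by (rule card_mono) (use S(1) in auto)
    ultimately show False using k by simp
  qed
  have b: "b > 0" using k by (cases b) auto
  have M0: "M i i" for i using S(2)[of i] b by (auto simp: M_def)
  have M1: "\<not> M i (i + 1)" for i using d1 by (simp add: M_def)
  have anti: "\<not> M (i + 1) j" if "M i (j + 1)" for i j using d2 that by (simp add: M_def)
  have M2: "\<not> M i (i + 2)" for i using anti[of i "i + 1"] M0 by (auto simp: algebra_simps)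
  have Mper: "M (i + 2 ^ m) (j + 2 ^ m) \<longleftrightarrow> M i j" "M i (j + 2 ^ m) \<longleftrightarrow> M i j" for i j
    using per by (simp_all add: M_def)
  \<comment> \<open>Uniformity at \<open>e\<close> and \<open>e + 1\<close> passes to
    \<open>e + 2\<close>. If sets at distance \<open>e + 1\<close> always meet, a miss at distance
    \<open>e + 2\<close> propagates to the next index and, by periodicity, to all. If they never
    meet, the behaviour at \<open>e + 2\<close> is opposite to that at \<open>e\<close>, by
    \<open>anti\<close> or by \<open>four\<close>.\<close>
  have uniform: "(\<forall>i. M i (i + int d)) \<or> (\<forall>i. \<not> M i (i + int d))" for d
  proof (induction d rule: less_induct)
    case (less d)
    consider "d = 0" | "d = 1" | e where "d = Suc (Suc e)" by (metis One_nat_def not0_implies_Suc)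
    then show ?case
    proof cases
      case (3 e)
      have e: "(\<forall>i. M i (i + int e)) \<or> (\<forall>i. \<not> M i (i + int e))"
        "(\<forall>i. M i (i + int e + 1)) \<or> (\<forall>i. \<not> M i (i + int e + 1))"
        using less[of e] less[of "Suc e"] 3 by (auto simp: algebra_simps)
      have "(\<forall>i. M i (i + int e + 2)) \<or> (\<forall>i. \<not> M i (i + int e + 2))"
        using e(2)
      proof
        assume P: "\<forall>i. M i (i + int e + 1)"
        have A: "\<not> M i (i + int e + 3)" for i
          using anti[of i "i + int e + 2"] P[rule_format, of "i + 1"] by (auto simp: algebra_simps)
        have nxt: "\<not> M (i + 1) (i + 1 + int e + 2)" if "\<not> M i (i + int e + 2)" for i
        proof -
          have "M i (i + int e + 4)"
            using four[of i "i + int e + 2" "i + int e + 3" "i + int e + 4"] that A[of i]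
              M1[of "i + int e + 2"] M2[of "i + int e + 2"] M1[of "i + int e + 3"]
            by (auto simp: algebra_simps)
          then show ?thesis using anti[of i "i + int e + 3"] by (auto simp: algebra_simps)
        qed
        show ?thesis
        proof (rule disjCI, rule allI)
          fix i assume "\<not> (\<forall>i. \<not> M i (i + int e + 2))"
          then obtain j where j: "M j (j + int e + 2)" by blast
          show "M i (i + int e + 2)"
          proof (rule ccontr)
            assume n: "\<not> M i (i + int e + 2)"
            have up: "\<not> M (i + int t) (i + int t + int e + 2)" for t
            proof (induction t)
              case (Suc t)
              then show ?case using nxt[of "i + int t"] by (simp add: ac_simps)
            qed (use n in simp)
            have shift: "M (j + int t * 2 ^ m) (j + int t * 2 ^ m + int e + 2)" for t
            proof (induction t)
              case (Suc t)
              then show ?case using Mper(1)[of "j + int t * 2 ^ m" "j + int t * 2 ^ m + int e + 2"]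
                by (simp add: algebra_simps)
            qed (use j in simp)
            \<comment> \<open>This many periods carry the index \<open>j\<close> to \<open>i\<close>
              or beyond, where the miss has already propagated.\<close>
            define t where "t = nat \<bar>i - j\<bar>"
            have "int t * 1 \<le> int t * 2 ^ m" by (rule mult_left_mono) auto
            then have "j + int t * 2 ^ m \<ge> i" by (simp add: t_def)
            then obtain u where "j + int t * 2 ^ m = i + int u" by (metis zle_iff_zadd)
            then show False using up[of u] shift[of t] by simp
          qed
        qed
      next
        assume A: "\<forall>i. \<not> M i (i + int e + 1)"
        show ?thesis using e(1)
        proof
          assume P: "\<forall>i. M i (i + int e)"
          have "\<not> M i (i + int e + 2)" for i
            using anti[of i "i + int e + 1"] P[rule_format, of "i + 1"] by (auto simp: algebra_simps)
          then show ?thesis by blast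
        next
          assume A': "\<forall>i. \<not> M i (i + int e)"
          have "M i (i + int e + 2)" for i
            using four[of i "i + int e" "i + int e + 1" "i + int e + 2"] A A'
              M1[of "i + int e"] M2[of "i + int e"] M1[of "i + int e + 1"] by (auto simp: algebra_simps)
          then show ?thesis by blast
        qed
      qed
      then show ?thesis using 3 by (auto simp: algebra_simps)
    qed (use M0 M1 in auto)
  qed
  have shift: "M i (i + d) \<longleftrightarrow> M j (j + d)" for i j d :: int
  proof (cases "d \<ge> 0")
    case True
    then show ?thesis using uniform[of "nat d"] by auto
  next
    case False
    define e where "e = nat (- d)"
    have "d = - int e" using False by (simp add: e_def)
    then show ?thesis using uniform[of e] Msym[of i "i + d"] Msym[of j "j + d"]
      by (metis add.right_neutral add_diff_cancel_right' diff_add_cancel uminus_add_conv_diff add.commute)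
  qed
  define P where "P d \<longleftrightarrow> M 0 d" for d :: int
  have MP: "M i j \<longleftrightarrow> P (j - i)" for i j using shift[of i "j - i" 0] by (simp add: P_def)
  show False
  proof (rule no_dyadic_period[of P m])
    show "P 0" using M0 by (simp add: P_def)
    show "P (- d) \<longleftrightarrow> P d" for d using Msym[of 0 d] by (simp add: MP)
    show "\<not> P (d + 2)" if "P d" for d
      using anti[of 0 "d + 1"] that MP[of 1 "d + 1"] by (auto simp: P_def algebra_simps)
    show "P a \<or> P c \<or> P e \<or> P (c - a) \<or> P (e - a) \<or> P (e - c)" for a c e
      using four[of 0 a c e] by (simp add: MP)
    show "P (d + 2 ^ m) \<longleftrightarrow> P d" for d using Mper(2)[of 0 d] by (simp add: P_def)
  qed
qed

section \<open>Directed cycles: orientation, girth and a plane drawing\<close>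

definition dicycle :: "nat \<Rightarrow> (nat \<times> nat) set" where
  "dicycle n = (\<lambda>i. (i, Suc i mod n)) ` {..<n}"

lemma dicycle_iff: "(x, y) \<in> dicycle n \<longleftrightarrow> x < n \<and> y = Suc x mod n"
  by (auto simp: dicycle_def)

lemma oriented_graph_dicycle:
  assumes "n \<ge> 3"
  shows "oriented_graph {..<n} (dicycle n)"
proof -
  have "x \<noteq> Suc x mod n \<and> Suc (Suc x mod n) mod n \<noteq> x" if "x < n" for x
  proof (cases "Suc x = n")
    case True
    then show ?thesis using assms that by (auto simp: mod_Suc)
  next
    case False
    then show ?thesis using assms that by (auto simp: mod_Suc)
  qed
  then show ?thesis using assms unfolding oriented_graph_def by (auto simp: dicycle_iff) metis
qed

text \<open>A vertex on an undirected cycle has two distinct neighbours there, of which only one can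
  be its predecessor in \<open>dicycle n\<close>. So its successor is on the cycle too, and
  following successors reaches all \<open>n\<close> vertices.\<close>

lemma girth_dicycle:
  assumes "n \<ge> 3"
  shows "girth_at_least {..<n} (dicycle n) n"
  unfolding girth_at_least_def
proof (intro allI impI)
  fix cs assume c: "und_cycle {..<n} (dicycle n) cs"
  define l where "l = length cs"
  have l: "l \<ge> 3" "distinct cs" "set cs \<subseteq> {..<n}"
    and adj: "\<And>i. i < l \<Longrightarrow> und_adj (dicycle n) (cs ! i) (cs ! (Suc i mod l))"
    using c by (auto simp: und_cycle_def l_def)
  have suc: "Suc x mod n \<in> set cs" if x: "x \<in> set cs" for x
  proof -
    obtain i where i: "i < l" "x = cs ! i" using x by (auto simp: in_set_conv_nth l_def)
    \<comment> \<open>The position before \<open>i\<close> differs from the one after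
      \<open>i\<close>, as the length is at least three.\<close>
    obtain j where j: "j < l" "Suc j mod l = i" "j \<noteq> Suc i mod l"
    proof (cases i)
      case 0
      have "Suc (l - 1) = l" "Suc 0 mod l = Suc 0" using l(1) by auto
      then show ?thesis using that[of "l - 1"] 0 l(1) by auto
    next
      case (Suc h)
      have "h \<noteq> Suc i mod l"
        using Suc i(1) l(1) by (cases "Suc i = l") auto
      then show ?thesis using that[of h] Suc i(1) by auto
    qed
    have k: "Suc i mod l < l" using l(1) by simp
    then have ne: "cs ! (Suc i mod l) \<noteq> cs ! j"
      using l(2) j(1,3) k nth_eq_iff_index_eq[of cs "Suc i mod l" j] unfolding l_def by metis
    have mem: "cs ! (Suc i mod l) \<in> set cs" "cs ! j \<in> set cs" using j(1) k nth_mem unfolding l_def by blast+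
    have "und_adj (dicycle n) x (cs ! (Suc i mod l))" "und_adj (dicycle n) x (cs ! j)"
      using adj[OF i(1)] adj[OF j(1)] unfolding j(2) i(2) und_adj_def by blast+
    moreover have "y = z" if "y < n" "z < n" "x = Suc y mod n" "x = Suc z mod n" for y z
      using that by (auto simp: mod_Suc split: if_splits)
    ultimately show ?thesis using ne mem unfolding und_adj_def dicycle_iff by metis
  qed
  have "cs \<noteq> []" using l(1) by (auto simp: l_def)
  then obtain a where a: "a \<in> set cs" by (meson hd_in_set)
  have an: "a < n" using a l by auto
  have "(a + t) mod n \<in> set cs" for t
  proof (induction t)
    case (Suc t)
    then show ?case using suc[of "(a + t) mod n"] by (simp add: mod_Suc_eq)
  qed (use a an in simp)
  moreover have "(a + (x + n - a)) mod n = x" if "x < n" for x using that an by simp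
  ultimately have all: "x \<in> set cs" if "x < n" for x using that by metis
  then have "{..<n} \<subseteq> set cs" by auto
  then have "card {..<n} \<le> card (set cs)" by (intro card_mono) auto
  then show "n \<le> length cs" using card_length[of cs] by simp
qed

text \<open>The vertices lie on the horizontal axis and consecutive ones are joined by segments. The
  closing edge is a parabolic arch that meets the axis only in its ends.\<close>

lemma planar_dicycle:
  assumes "n \<ge> 3"
  shows "planar {..<n} (dicycle n)"
proof -
  define p :: "nat \<Rightarrow> real^2" where "p i = vector [real i, 0]" for i
  define w where "w = real (n - 1)"
  define \<gamma> :: "nat \<times> nat \<Rightarrow> real \<Rightarrow> real^2" where
    "\<gamma> e t = (if snd e = 0 then vector [w * (1 - t), t * (1 - t)] else vector [real (fst e) + t, 0])" for e t
  have w: "w > 0" using assms by (simp add: w_def)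
  have eq: "(vector [a, b] :: real^2) = vector [c, d] \<longleftrightarrow> a = c \<and> b = d" for a b c d
    by (auto simp: vec_eq_iff forall_2)
  have cont: "continuous_on {0..1} (\<lambda>t. vector [f t, g t] :: real^2)"
    if "continuous_on {0..1} f" "continuous_on {0..1} g" for f g :: "real \<Rightarrow> real"
  proof -
    have "(\<lambda>t. vector [f t, g t] :: real^2) = (\<lambda>t. \<chi> i. if i = 1 then f t else g t)"
      by (auto simp: fun_eq_iff vec_eq_iff forall_2)
    moreover have "continuous_on {0..1} (\<lambda>t. (\<chi> i. if i = 1 then f t else g t) :: real^2)"
      by (rule continuous_on_vec_lambda, rename_tac i, case_tac "i = (1 :: 2)") (use that in auto)
    ultimately show ?thesis by (simp only:)
  qed
  have arcs: "arc (\<gamma> (u, v)) \<and> pathstart (\<gamma> (u, v)) = p u \<and> pathfinish (\<gamma> (u, v)) = p v \<and>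
      path_image (\<gamma> (u, v)) \<inter> p ` {..<n} = {p u, p v}" if "(u, v) \<in> dicycle n" for u v
  proof (cases "v = 0")
    case True
    then have u: "u = n - 1" using that assms by (auto simp: dicycle_iff mod_Suc split: if_splits)
    have g: "\<gamma> (u, v) = (\<lambda>t. vector [w * (1 - t), t * (1 - t)])" by (auto simp: \<gamma>_def True fun_eq_iff)
    have "arc (\<gamma> (u, v))"
      unfolding arc_def path_def g using w by (auto intro!: cont continuous_intros inj_onI simp: eq)
    moreover have st: "pathstart (\<gamma> (u, v)) = p u" "pathfinish (\<gamma> (u, v)) = p v"
      unfolding pathstart_def pathfinish_def g by (auto simp: p_def u True w_def)
    moreover have "path_image (\<gamma> (u, v)) \<inter> p ` {..<n} \<subseteq> {p u, p v}"
      unfolding path_image_def g by (auto simp: eq p_def u True w_def)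
    moreover have "{p u, p v} \<subseteq> path_image (\<gamma> (u, v))" unfolding st[symmetric] by (simp add: pathstart_in_path_image pathfinish_in_path_image)
    moreover have "{p u, p v} \<subseteq> p ` {..<n}" using assms u True by auto
    ultimately show ?thesis by blast
  next
    case False
    then have v: "v = Suc u" "v < n" using that assms by (auto simp: dicycle_iff mod_Suc split: if_splits)
    have g: "\<gamma> (u, v) = (\<lambda>t. vector [real u + t, 0])" using False by (auto simp: \<gamma>_def fun_eq_iff)
    have "arc (\<gamma> (u, v))"
      unfolding arc_def path_def g by (auto intro!: cont continuous_intros inj_onI simp: eq)
    moreover have st: "pathstart (\<gamma> (u, v)) = p u" "pathfinish (\<gamma> (u, v)) = p v"
      unfolding pathstart_def pathfinish_def g by (auto simp: p_def v eq)
    moreover have "path_image (\<gamma> (u, v)) \<inter> p ` {..<n} \<subseteq> {p u, p v}"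
    proof
      fix z assume "z \<in> path_image (\<gamma> (u, v)) \<inter> p ` {..<n}"
      then obtain t i where t: "0 \<le> t" "t \<le> 1" "z = vector [real u + t, 0]" "z = p i"
        by (auto simp: path_image_def g)
      then have "real i = real u + t" by (simp add: p_def eq)
      then have "i = u \<or> i = Suc u" using t by linarith
      then show "z \<in> {p u, p v}" using t v by auto
    qed
    moreover have "{p u, p v} \<subseteq> path_image (\<gamma> (u, v))" unfolding st[symmetric] by (simp add: pathstart_in_path_image pathfinish_in_path_image)
    moreover have "{p u, p v} \<subseteq> p ` {..<n}" using v by auto
    ultimately show ?thesis by blast
  qed
  have flat: "z $ 2 = 0" if "z \<in> path_image (\<gamma> e)" "snd e \<noteq> 0" for z e
    using that by (auto simp: path_image_def \<gamma>_def)
  have bump: "z \<in> p ` {..<n}" if z: "z \<in> path_image (\<gamma> e)" "snd e = 0" "z $ 2 = 0" for z e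
  proof -
    obtain t where t: "z = vector [w * (1 - t), t * (1 - t)]" using z(1,2) by (auto simp: path_image_def \<gamma>_def)
    then have "t = 0 \<or> t = 1" using z(3) by simp
    then have "z = p (n - 1) \<or> z = p 0" using t by (auto simp: p_def w_def)
    then show ?thesis using assms by auto
  qed
  have cross: "path_image (\<gamma> e) \<inter> path_image (\<gamma> e') \<subseteq> p ` {..<n}"
    if e: "e \<in> dicycle n" "e' \<in> dicycle n" "e \<noteq> e'" for e e'
  proof
    fix z assume z: "z \<in> path_image (\<gamma> e) \<inter> path_image (\<gamma> e')"
    obtain u v u' v' where uv: "e = (u, v)" "e' = (u', v')" by (metis surj_pair)
    have dist: "u \<noteq> u'" "v \<noteq> 0 \<or> v' \<noteq> 0" "u < n" "u' < n"
      using e by (auto simp: uv dicycle_iff mod_Suc split: if_splits)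
    show "z \<in> p ` {..<n}"
    proof (cases "v \<noteq> 0 \<and> v' \<noteq> 0")
      case True
      obtain t t' where t: "0 \<le> t" "t \<le> 1" "z = vector [real u + t, 0]" "0 \<le> t'" "t' \<le> 1" "z = vector [real u' + t', 0]"
        using z True by (auto simp: path_image_def \<gamma>_def uv)
      then have s: "real u + t = real u' + t'" by (simp add: eq)
      have "t = 0 \<or> t' = 0" using s t(1,2,4,5) dist(1) by linarith
      then have "z = p u \<or> z = p u'" using t by (auto simp: p_def)
      then show ?thesis using dist by auto
    next
      case False
      then show ?thesis using dist(2) z flat[of z e] flat[of z e'] bump[of z e] bump[of z e'] by (auto simp: uv)
    qed
  qed
  have "inj_on p {..<n}" by (auto simp: inj_on_def p_def eq)
  then show ?thesis unfolding planar_def using arcs cross by blast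
qed

text \<open>Disjoint blocks of \<open>b\<close> colours for distinct vertices give some colouring,
  so the \<open>LEAST\<close> is attained.\<close>

lemma chi_o_b_attained:
  assumes "oriented_graph V A"
  shows "\<exists>f. bfold_oriented_coloring V A b (chi_o_b V A b) f"
proof -
  define N where "N = Suc (Max (insert 0 V))"
  define f where "f v = {v * b..<v * b + b}" for v
  have V: "finite V" using assms by (simp add: oriented_graph_def)
  have dj: "f x \<inter> f y = {}" if "x \<noteq> y" for x y
  proof -
    have "f x \<inter> f y = {}" if "x < y" for x y
    proof -
      have "x * b + b \<le> y * b" using mult_le_mono1[of "Suc x" y b] that by simp
      then show ?thesis by (auto simp: f_def)
    qed
    then show ?thesis using that by (metis Int_commute linorder_neqE_nat)
  qed
  have "f v \<subseteq> {..<N * b} \<and> card (f v) = b" if "v \<in> V" for v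
  proof -
    have "v < N" using that V by (simp add: N_def less_Suc_eq_le)
    then have "v * b + b \<le> N * b" using mult_le_mono1[of "Suc v" N b] by simp
    then show ?thesis by (auto simp: f_def)
  qed
  then have "bfold_oriented_coloring V A b (N * b) f"
    using assms dj unfolding bfold_oriented_coloring_def oriented_graph_def by metis
  then show ?thesis unfolding chi_o_b_def using LeastI_ex[of "\<lambda>k. \<exists>f. bfold_oriented_coloring V A b k f"] by blast
qed

lemma dyadic_dicycle_chi_o_b:
  assumes "m \<ge> 2"
  shows "4 * b \<le> chi_o_b {..<2 ^ m} (dicycle (2 ^ m)) b"
proof -
  define n :: nat where "n = 2 ^ m"
  have n: "n \<ge> 4" using power_increasing[OF assms, of "2::nat"] by (simp add: n_def)
  obtain f where f: "bfold_oriented_coloring {..<n} (dicycle n) b (chi_o_b {..<n} (dicycle n) b) f"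
    using chi_o_b_attained[OF oriented_graph_dicycle] n by fastforce
  \<comment> \<open>Reduction modulo \<open>n\<close> unrolls the cycle along the integers.\<close>
  define r where "r i = nat (i mod int n)" for i :: int
  have r: "r i < n" for i using n by (simp add: r_def nat_less_iff)
  have arc: "(r i, r (i + 1)) \<in> dicycle n" for i
  proof -
    have "int (Suc (r i) mod n) = (i + 1) mod int n"
      using n by (simp add: r_def zmod_int mod_add_right_eq add.commute)
    then have "r (i + 1) = Suc (r i) mod n" by (metis r_def nat_int)
    then show ?thesis using r by (simp add: dicycle_iff)
  qed
  have "4 * b \<le> chi_o_b {..<n} (dicycle n) b"
  proof (rule dyadic_cycle_colors_ge[of "\<lambda>i. f (r i)" _ b m])
    show "f (r i) \<subseteq> {..<chi_o_b {..<n} (dicycle n) b}" "card (f (r i)) = b" for i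
      using f r unfolding bfold_oriented_coloring_def by blast+
    show "f (r i) \<inter> f (r (i + 1)) = {}" for i
      using f arc unfolding bfold_oriented_coloring_def by blast
    show "f (r (i + 1)) \<inter> f (r j) = {}" if "f (r i) \<inter> f (r (j + 1)) \<noteq> {}" for i j
      using f arc[of i] arc[of j] that unfolding bfold_oriented_coloring_def by blast
    show "f (r (i + 2 ^ m)) = f (r i)" for i
      by (simp add: r_def n_def)
  qed
  then show ?thesis by (simp add: n_def)
qed

lemma chi_o_frac_family_ge_4: "4 \<le> chi_o_frac_family (P_family g)"
proof -
  \<comment> \<open>Since \<open>m < 2 ^ m\<close>, the cycle is long enough for girth
    \<open>g\<close>; the summand 2 meets the requirement \<open>2 \<le> m\<close> of the colour
    bound.\<close>
  define m where "m = g + 2"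
  define n :: nat where "n = 2 ^ m"
  have "m < n" by (simp add: n_def)
  then have n: "n \<ge> 3" "n \<ge> g" by (auto simp: m_def)
  have "girth_at_least {..<n} (dicycle n) g"
    using girth_dicycle[OF n(1)] n(2) unfolding girth_at_least_def by (meson order_trans)
  then have mem: "({..<n}, dicycle n) \<in> P_family g"
    using n oriented_graph_dicycle planar_dicycle by (simp add: P_family_def)
  have "4 \<le> real (chi_o_b {..<n} (dicycle n) b) / real b" if "b \<ge> 1" for b
  proof -
    have "real (4 * b) \<le> real (chi_o_b {..<n} (dicycle n) b)"
      unfolding of_nat_le_iff n_def by (rule dyadic_dicycle_chi_o_b) (simp add: m_def)
    then show ?thesis using that by (simp add: le_divide_eq)
  qed
  then have "4 \<le> chi_o_frac {..<n} (dicycle n)"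
    unfolding chi_o_frac_def by (intro cINF_greatest) auto
  then have "4 \<le> ereal (chi_o_frac (fst ({..<n}, dicycle n)) (snd ({..<n}, dicycle n)))" by simp
  also have "\<dots> \<le> chi_o_frac_family (P_family g)"
    unfolding chi_o_frac_family_def by (rule SUP_upper[OF mem])
  finally show ?thesis .
qed

section \<open>Circular colourings\<close>

text \<open>Colours lie on a circle of length \<open>4 * b + 1\<close>; the integer \<open>c v\<close>, read modulo
  this length, is the left end of the interval of \<open>b\<close> colours assigned to \<open>v\<close>.\<close>

definition circ_arc :: "nat \<Rightarrow> int \<Rightarrow> int \<Rightarrow> bool" where
  "circ_arc b u w \<longleftrightarrow> (\<exists>t\<in>{0, 1}. int (4 * b + 1) dvd w - u - int b - t)"

definition circ_coloring :: "(nat \<times> nat) set \<Rightarrow> nat \<Rightarrow> (nat \<Rightarrow> int) \<Rightarrow> bool" where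
  "circ_coloring A b c \<longleftrightarrow> (\<forall>(x, y)\<in>A. circ_arc b (c x) (c y))"

lemma circ_arc_shift:
  assumes "int (4 * b + 1) dvd d"
  shows "circ_arc b u (w + d) \<longleftrightarrow> circ_arc b u w" "circ_arc b (u + d) w \<longleftrightarrow> circ_arc b u w"
proof -
  have "w + d - u - int b - t = (w - u - int b - t) + d" "w - (u + d) - int b - t = (w - u - int b - t) - d" for t
    by auto
  then show "circ_arc b u (w + d) \<longleftrightarrow> circ_arc b u w" "circ_arc b (u + d) w \<longleftrightarrow> circ_arc b u w"
    unfolding circ_arc_def using assms by (simp_all only: dvd_add_left_iff dvd_diff_left_iff)
qed

text \<open>\<open>s i\<close> records whether step \<open>i\<close> follows its arc. Each step
  moves by \<open>b\<close> or \<open>b + 1\<close>, up or down, so the interval of reachable end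
  values gains one integer per step.\<close>

lemma circ_walk_range:
  fixes s :: "nat \<Rightarrow> bool"
  shows "\<exists>m. \<forall>r\<in>{m..m + int L}. \<exists>d. d 0 = a \<and> d L = r \<and>
    (\<forall>i<L. if s i then circ_arc b (d i) (d (Suc i)) else circ_arc b (d (Suc i)) (d i))"
proof (induction L)
  case 0
  show ?case by (intro exI[of _ a] ballI exI[of _ "\<lambda>_. a"]) auto
next
  case (Suc L)
  then obtain m where m: "\<And>r. r \<in> {m..m + int L} \<Longrightarrow> \<exists>d. d 0 = a \<and> d L = r \<and>
    (\<forall>i<L. if s i then circ_arc b (d i) (d (Suc i)) else circ_arc b (d (Suc i)) (d i))" by blast
  have ext: "\<exists>d. d 0 = a \<and> d (Suc L) = r \<and>
    (\<forall>i<Suc L. if s i then circ_arc b (d i) (d (Suc i)) else circ_arc b (d (Suc i)) (d i))"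
    if q: "q \<in> {m..m + int L}" "if s L then circ_arc b q r else circ_arc b r q" for q r
  proof -
    obtain d where d: "d 0 = a" "d L = q"
      "\<forall>i<L. if s i then circ_arc b (d i) (d (Suc i)) else circ_arc b (d (Suc i)) (d i)"
      using m[OF q(1)] by blast
    show ?thesis
      by (rule exI[of _ "d(Suc L := r)"]) (use d q(2) in \<open>auto simp: less_Suc_eq\<close>)
  qed
  show ?case
  proof (cases "s L")
    case True
    show ?thesis
    proof (intro exI[of _ "m + int b"] ballI)
      fix r assume r: "r \<in> {m + int b..m + int b + int (Suc L)}"
      show "\<exists>d. d 0 = a \<and> d (Suc L) = r \<and>
        (\<forall>i<Suc L. if s i then circ_arc b (d i) (d (Suc i)) else circ_arc b (d (Suc i)) (d i))"
      proof (cases "r = m + int b + int (Suc L)")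
        case True
        then show ?thesis by (intro ext[of "m + int L"]) (use \<open>s L\<close> in \<open>auto simp: circ_arc_def\<close>)
      next
        case False
        then show ?thesis using r by (intro ext[of "r - int b"]) (use \<open>s L\<close> in \<open>auto simp: circ_arc_def\<close>)
      qed
    qed
  next
    case False
    show ?thesis
    proof (intro exI[of _ "m - int b - 1"] ballI)
      fix r assume r: "r \<in> {m - int b - 1..m - int b - 1 + int (Suc L)}"
      show "\<exists>d. d 0 = a \<and> d (Suc L) = r \<and>
        (\<forall>i<Suc L. if s i then circ_arc b (d i) (d (Suc i)) else circ_arc b (d (Suc i)) (d i))"
      proof (cases "r = m - int b - 1")
        case True
        then show ?thesis by (intro ext[of m]) (use \<open>\<not> s L\<close> in \<open>auto simp: circ_arc_def\<close>)
      next
        case False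
        then show ?thesis using r by (intro ext[of "r + int b"]) (use \<open>\<not> s L\<close> in \<open>auto simp: circ_arc_def\<close>)
      qed
    qed
  qed
qed

text \<open>The reachable interval is long enough to contain an integer congruent to
  \<open>w\<close>. Since \<open>circ_arc\<close> depends on residues only, the last value may be
  replaced by \<open>w\<close> itself.\<close>

lemma circ_walk_exists:
  fixes s :: "nat \<Rightarrow> bool"
  assumes L: "4 * b + 1 \<le> L"
  obtains d where "d 0 = a" "d L = w"
    "\<And>i. i < L \<Longrightarrow> if s i then circ_arc b (d i) (d (Suc i)) else circ_arc b (d (Suc i)) (d i)"
proof -
  let ?k = "int (4 * b + 1)"
  obtain m where m: "\<And>r. r \<in> {m..m + int L} \<Longrightarrow> \<exists>d. d 0 = a \<and> d L = r \<and>
    (\<forall>i<L. if s i then circ_arc b (d i) (d (Suc i)) else circ_arc b (d (Suc i)) (d i))"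
    using circ_walk_range[of L a s b] by blast
  define r where "r = m + (w - m) mod ?k"
  have "0 \<le> (w - m) mod ?k" "(w - m) mod ?k < ?k" by (rule pos_mod_sign pos_mod_bound; simp)+
  moreover have "?k \<le> int L" using L by (simp only: of_nat_le_iff)
  ultimately have "r \<in> {m..m + int L}" unfolding r_def atLeastAtMost_iff by linarith
  then obtain d where d: "d 0 = a" "d L = r"
    "\<And>i. i < L \<Longrightarrow> if s i then circ_arc b (d i) (d (Suc i)) else circ_arc b (d (Suc i)) (d i)"
    using m by blast
  have "w - r = (w - m) - (w - m) mod ?k" by (simp add: r_def)
  then have "?k dvd w - r" by (simp only: dvd_minus_mod)
  note shift = circ_arc_shift[OF this]
  show ?thesis
  proof (rule that[of "d(L := w)"])
    show "(d(L := w)) 0 = a" using d L by auto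
    fix i assume i: "i < L"
    show "if s i then circ_arc b ((d(L := w)) i) ((d(L := w)) (Suc i))
        else circ_arc b ((d(L := w)) (Suc i)) ((d(L := w)) i)"
    proof (cases "Suc i = L")
      case True
      then show ?thesis using d(3)[OF i] d(2) shift(1)[of "d i" r] shift(2)[of r "d i"] i by auto
    next
      case False
      then show ?thesis using d(3)[OF i] i by auto
    qed
  qed simp
qed

text \<open>By induction on the number of vertices: a leaf, or the inner vertices of a thread, are
  deleted, the rest is coloured, and the colouring is extended.\<close>

lemma circ_coloring_exists:
  assumes "(V, A) \<in> P_family g" and b: "b \<ge> 1" and L: "4 * b + 1 \<le> L" and g: "12 * L + 7 \<le> g"
  shows "\<exists>c. circ_coloring A b c"
  using assms(1)
proof (induction "card V" arbitrary: V A rule: less_induct)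
  case less
  have or: "oriented_graph V A" using less.prems by (simp add: P_family_def)
  then have V: "finite V" and AV: "A \<subseteq> V \<times> V" and asym: "\<And>x y. (x, y) \<in> A \<Longrightarrow> x \<noteq> y \<and> (y, x) \<notin> A"
    by (auto simp: oriented_graph_def)
  have sub: "\<exists>c. circ_coloring (A \<inter> W \<times> W) b c" if "W \<subset> V" for W
    using less.hyps[of W "A \<inter> W \<times> W"] P_family_induced_subgraph[OF less.prems, of W] that V
    by (auto simp: psubset_card_mono)
  show ?case
  proof (cases "V = {}")
    case True
    then show ?thesis using AV by (auto simp: circ_coloring_def)
  next
    case False
    from leaf_or_thread[OF less.prems False g] show ?thesis
    proof
      assume "\<exists>v\<in>V. \<exists>u. nbrs A v \<subseteq> {u}"
      then obtain v u where v: "v \<in> V" "\<And>y. und_adj A v y \<Longrightarrow> y = u" by blast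
      obtain c where c: "circ_coloring (A \<inter> (V - {v}) \<times> (V - {v})) b c" using sub[of "V - {v}"] v by blast
      \<comment> \<open>At most one arc constrains \<open>v\<close>, and a shift by \<open>b\<close>
        in its direction satisfies it.\<close>
      let ?c = "c(v := if (u, v) \<in> A then c u + int b else c u - int b)"
      have "circ_arc b (?c x) (?c y)" if xy: "(x, y) \<in> A" for x y
      proof (cases "x = v \<or> y = v")
        case False
        then show ?thesis using c xy AV by (auto simp: circ_coloring_def)
      next
        case True
        then consider "x = v" "y = u" | "x = u" "y = v" using v(2) xy by (auto simp: und_adj_def)
        then show ?thesis by cases (use asym xy in \<open>auto simp: circ_arc_def\<close>)
      qed
      then show ?thesis unfolding circ_coloring_def by blast
    next
      assume "\<exists>x. thread A L x"
      then obtain x where x: "inj_on x {..L}" "\<And>i. i < L \<Longrightarrow> und_adj A (x i) (x (Suc i))"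
        "\<And>i. Suc i < L \<Longrightarrow> nbrs A (x (Suc i)) = {x i, x (Suc (Suc i))}"
        unfolding thread_def by blast
      define I where "I = x ` {0<..<L}"
      obtain c where c: "circ_coloring (A \<inter> (V - I) \<times> (V - I)) b c"
      proof -
        have "1 < L" using L b by simp
        then have "x 1 \<in> I" "x 1 \<in> V" using x(2)[of 1] AV by (auto simp: I_def und_adj_def)
        then show ?thesis using sub[of "V - I"] that by blast
      qed
      \<comment> \<open>The ends of the thread keep their values; a walk with the orientation
        pattern of the thread connects them.\<close>
      obtain d where d: "d 0 = c (x 0)" "d L = c (x L)"
        "\<And>i. i < L \<Longrightarrow> if (x i, x (Suc i)) \<in> A then circ_arc b (d i) (d (Suc i)) else circ_arc b (d (Suc i)) (d i)"
        using circ_walk_exists[OF L, of "c (x 0)" "c (x L)" "\<lambda>i. (x i, x (Suc i)) \<in> A"] by blast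
      define c' where "c' v = (if v \<in> I then d (inv_into {..L} x v) else c v)" for v
      have notI: "x 0 \<notin> I" "x L \<notin> I" unfolding I_def using inj_onD[OF x(1)] by fastforce+
      have c'x: "c' (x i) = d i" if "i \<le> L" for i
      proof (cases "x i \<in> I")
        case True
        then show ?thesis using that x(1) by (simp add: c'_def)
      next
        case False
        then have "i = 0 \<or> i = L" using that by (auto simp: I_def)
        then show ?thesis using d notI by (auto simp: c'_def)
      qed
      \<comment> \<open>Every arc at a deleted vertex is an edge of the thread; all other arcs see
        unchanged values.\<close>
      have inner: "\<exists>i<L. {u, v} = {x i, x (Suc i)}" if uv: "und_adj A u v" "u \<in> I" for u v
      proof -
        obtain i where i: "0 < i" "i < L" "u = x i" using uv by (auto simp: I_def)
        then obtain j where j: "i = Suc j" by (cases i) auto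
        have "v = x j \<or> v = x (Suc (Suc j))" using x(3)[of j] i j uv by blast
        then show ?thesis
        proof
          assume "v = x j" then show ?thesis using i j by (intro exI[of _ j]) auto
        next
          assume "v = x (Suc (Suc j))" then show ?thesis using i j by (intro exI[of _ i]) auto
        qed
      qed
      have "circ_arc b (c' u) (c' v)" if uv: "(u, v) \<in> A" for u v
      proof (cases "u \<in> I \<or> v \<in> I")
        case False
        then show ?thesis using c uv AV by (auto simp: circ_coloring_def c'_def)
      next
        case True
        then obtain i where i: "i < L" "{u, v} = {x i, x (Suc i)}"
          using inner[of u v] inner[of v u] uv by (auto simp: und_adj_def insert_commute)
        then consider "u = x i" "v = x (Suc i)" | "u = x (Suc i)" "v = x i" by (auto simp: doubleton_eq_iff)
        then show ?thesis by cases (use d(3)[OF i(1)] uv asym[OF uv] c'x i in auto)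
      qed
      then show ?thesis unfolding circ_coloring_def by blast
    qed
  qed
qed

text \<open>Two intervals meet only if their left ends differ by less than \<open>b\<close> modulo
  \<open>4 * b + 1\<close>. A violation of (i) makes \<open>r + b + t\<close> a multiple of
  \<open>4 * b + 1\<close>, though it lies between 1 and \<open>2 * b\<close>. A violation of (ii)
  does so for \<open>2 * b + t + s - q + r\<close>, which lies between 2 and
  \<open>4 * b\<close>.\<close>

lemma bfold_of_circ_coloring:
  assumes c: "circ_coloring A b c"
  shows "bfold_oriented_coloring V A b (4 * b + 1)
    (\<lambda>v. (\<lambda>i. nat ((c v + int i) mod int (4 * b + 1))) ` {..<b})" (is "bfold_oriented_coloring V A b ?k ?f")
proof -
  have mod_eq: "nat (a mod int ?k) = nat (e mod int ?k) \<longleftrightarrow> int ?k dvd a - e" for a e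
    by (simp add: nat_eq_iff mod_eq_dvd_iff[symmetric])
  have small: "z = 0" if "int ?k dvd z" "\<bar>z\<bar> < int ?k" for z
    using that dvd_imp_le_int[of z "int ?k"] by fastforce
  have arcD: "\<exists>t. (t = 0 \<or> t = 1) \<and> int ?k dvd c y - c x - int b - t" if "(x, y) \<in> A" for x y
    using c that unfolding circ_coloring_def circ_arc_def by blast
  have meet: "\<exists>r. \<bar>r\<bar> < int b \<and> int ?k dvd c x - c y - r" if xy: "?f x \<inter> ?f y \<noteq> {}" for x y
  proof -
    obtain i j where "i < b" "j < b" "nat ((c x + int i) mod int ?k) = nat ((c y + int j) mod int ?k)"
      using xy by blast
    then show ?thesis unfolding mod_eq by (intro exI[of _ "int j - int i"]) (auto simp: algebra_simps)
  qed
  have fv: "?f v \<subseteq> {..<?k} \<and> card (?f v) = b" for v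
  proof
    show "?f v \<subseteq> {..<?k}" by (auto simp: nat_less_iff)
    have "inj_on (\<lambda>i. nat ((c v + int i) mod int ?k)) {..<b}"
    proof (rule inj_onI)
      fix i j assume ij: "i \<in> {..<b}" "j \<in> {..<b}" "nat ((c v + int i) mod int ?k) = nat ((c v + int j) mod int ?k)"
      then have "int ?k dvd (c v + int i) - (c v + int j)" by (simp only: mod_eq)
      then have "int i - int j = 0" using ij by (intro small) auto
      then show "i = j" by simp
    qed
    then show "card (?f v) = b" by (simp add: card_image)
  qed
  have 1: "?f x \<inter> ?f y = {}" if xy: "(x, y) \<in> A" for x y
  proof (rule ccontr)
    assume "?f x \<inter> ?f y \<noteq> {}"
    then obtain r where r: "\<bar>r\<bar> < int b" "int ?k dvd c x - c y - r" using meet by blast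
    obtain t where t: "t = 0 \<or> t = 1" "int ?k dvd c y - c x - int b - t" using arcD[OF xy] by blast
    have "int ?k dvd (c x - c y - r) + (c y - c x - int b - t)" using r t by (intro dvd_add)
    then have "int ?k dvd - r - int b - t" by (simp add: algebra_simps)
    then have "- r - int b - t = 0" by (rule small) (use r t in auto)
    then show False using r t by auto
  qed
  have 2: "?f y \<inter> ?f z = {}" if xy: "(x, y) \<in> A" and zw: "(z, w) \<in> A" and xw: "?f x \<inter> ?f w \<noteq> {}" for x y z w
  proof (rule ccontr)
    assume "?f y \<inter> ?f z \<noteq> {}"
    then obtain q where q: "\<bar>q\<bar> < int b" "int ?k dvd c y - c z - q" using meet by blast
    obtain r where r: "\<bar>r\<bar> < int b" "int ?k dvd c x - c w - r" using meet[OF xw] by blast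
    obtain t where t: "t = 0 \<or> t = 1" "int ?k dvd c y - c x - int b - t" using arcD[OF xy] by blast
    obtain s where s: "s = 0 \<or> s = 1" "int ?k dvd c w - c z - int b - s" using arcD[OF zw] by blast
    \<comment> \<open>The left ends cancel around the four vertices, leaving the two shifts and the
      two offsets.\<close>
    have "int ?k dvd (c y - c z - q) - (c y - c x - int b - t) - (c w - c z - int b - s) - (c x - c w - r)"
      by (rule dvd_diff[OF dvd_diff[OF dvd_diff[OF q(2) t(2)] s(2)] r(2)])
    then have "int ?k dvd 2 * int b + t + s - q + r" by (simp add: algebra_simps)
    then have "2 * int b + t + s - q + r = 0" by (rule small) (use q r s t in auto)
    then show False using q r s t by auto
  qed
  show ?thesis unfolding bfold_oriented_coloring_def using fv 1 2 by blast
qed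

lemma chi_o_frac_le:
  assumes "bfold_oriented_coloring V A b k f" "b \<ge> 1"
  shows "chi_o_frac V A \<le> real k / real b"
proof -
  have "chi_o_b V A b \<le> k" unfolding chi_o_b_def by (rule Least_le) (use assms in blast)
  then have "real (chi_o_b V A b) / real b \<le> real k / real b" by (simp add: divide_right_mono)
  moreover have "chi_o_frac V A \<le> real (chi_o_b V A b) / real b"
    unfolding chi_o_frac_def by (rule cINF_lower) (use assms in \<open>auto intro!: bdd_belowI[of _ 0]\<close>)
  ultimately show ?thesis by linarith
qed

theorem theorem6:
  fixes \<epsilon> :: real
  assumes "\<epsilon> > 0"
  shows "\<exists>g::nat. 4 \<le> chi_o_frac_family (P_family g) \<and>
                  chi_o_frac_family (P_family g) \<le> ereal (4 + \<epsilon>)"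
proof -
  \<comment> \<open>Sets of size \<open>b\<close> among \<open>4 * b + 1\<close> colours give the
    ratio \<open>4 + 1 / b\<close>.\<close>
  obtain b :: nat where b: "b \<noteq> 0" "inverse (real b) < \<epsilon>"
    using reals_Archimedean[OF assms] by (metis Suc_not_Zero)
  \<comment> \<open>A thread of this length reaches every residue, and the girth chosen next is what
    \<open>leaf_or_thread\<close> needs for it.\<close>
  define L where "L = 4 * b + 1"
  define g where "g = 12 * L + 7"
  have "chi_o_frac_family (P_family g) \<le> ereal (4 + \<epsilon>)"
    unfolding chi_o_frac_family_def
  proof (rule SUP_least)
    fix G assume G: "G \<in> P_family g"
    obtain V A where VA: "G = (V, A)" by force
    obtain c where "circ_coloring A b c"
      using circ_coloring_exists[of V A g b L] G VA b(1) by (auto simp: g_def L_def)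
    then have "chi_o_frac V A \<le> real (4 * b + 1) / real b"
      using chi_o_frac_le[OF bfold_of_circ_coloring] b by simp
    also have "\<dots> = 4 + inverse (real b)" using b by (simp add: field_simps)
    also have "\<dots> \<le> 4 + \<epsilon>" using b by simp
    finally show "ereal (chi_o_frac (fst G) (snd G)) \<le> ereal (4 + \<epsilon>)" by (simp add: VA)
  qed
  then show ?thesis using chi_o_frac_family_ge_4 by blast
qed

end
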